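(* None of the sequences $(i_n)_{n\ge1}$, $(\mathrm{Com}_n)_{n\ge1}$ and $(s_n)_{n\ge1}$ is P-recursive.
   Context: A block of a permutation $\pi$ of $\{1,\ldots,n\}$ is a nonempty set of consecutive positions whose set of values under $\pi$ is a set of consecutive integers. A permutation of length $n$ is simple if its only blocks are the singletons and $\{1,\ldots,n\}$; $s_n$ is the number of simple permutations of length $n$. A permutation $\pi$ of length $n$ is plus indecomposable if there is no $1\le j<n$ with $\pi(\{1,\ldots,j\})=\{1,\ldots,j\}$; $i_n$ is the number of plus indecomposable permutations of length $n$. $\mathrm{Com}_n$ is the coefficient of $x^n$ in $F^{\langle -1\rangle}(x)$, the compositional inverse of the formal power series $F(x)=\sum_{k\ge1}k!\,x^k$. A sequence $(a_n)$ of numbers is P-recursive if it satisfies a (non-trivial) linear recurrence with polynomial coefficients, i.e. there are $d\ge 0$ and polynomials $p_0,\ldots,p_d\in\mathbf{C}[n]$, with $p_d\neq0$, such that $p_d(n)a_{n+d}+\cdots+p_0(n)a_n=0$ for all $n$. Equivalently, its ordinary generating function $\sum_n a_nx^n$ satisfies a non-trivial linear differential equation with polynomial coefficients. *)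

theory Defs
  imports
    Complex_Main
    "HOL-Combinatorics.Permutations"
    "HOL-Computational_Algebra.Polynomial"
    "HOL-Computational_Algebra.Formal_Power_Series"
begin

text \<open>
  Permutations of length \<open>n\<close> are functions \<open>\<pi>\<close> with \<open>\<pi> permutes {1..n}\<close>; such functions are the
  identity outside \<open>{1..n}\<close>, so there are exactly \<open>n!\<close> of them.
\<close>

definition is_block :: "nat \<Rightarrow> (nat \<Rightarrow> nat) \<Rightarrow> nat set \<Rightarrow> bool" where
  "is_block n \<pi> B \<longleftrightarrow>
     B \<noteq> {} \<and> B \<subseteq> {1..n} \<and> (\<exists>a b. B = {a..b}) \<and> (\<exists>c d. \<pi> ` B = {c..d})"

definition simple_perm :: "nat \<Rightarrow> (nat \<Rightarrow> nat) \<Rightarrow> bool" where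
  "simple_perm n \<pi> \<longleftrightarrow>
     \<pi> permutes {1..n} \<and> (\<forall>B. is_block n \<pi> B \<longrightarrow> is_singleton B \<or> B = {1..n})"

definition num_simple :: "nat \<Rightarrow> nat" where
  "num_simple n = card {\<pi>. simple_perm n \<pi>}"

definition plus_indecomposable :: "nat \<Rightarrow> (nat \<Rightarrow> nat) \<Rightarrow> bool" where
  "plus_indecomposable n \<pi> \<longleftrightarrow>
     \<pi> permutes {1..n} \<and> \<not> (\<exists>j. 1 \<le> j \<and> j < n \<and> \<pi> ` {1..j} = {1..j})"

definition num_plus_indecomposable :: "nat \<Rightarrow> nat" where
  "num_plus_indecomposable n = card {\<pi>. plus_indecomposable n \<pi>}"

definition fact_fps :: "complex fps" where
  "fact_fps = Abs_fps (\<lambda>k. if k = 0 then 0 else fact k)"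

text \<open>
  The constant term of \<open>fact_fps\<close> is \<open>0\<close> and its linear coefficient is \<open>1\<close>, so \<open>fps_inv\<close> is its
  genuine two-sided compositional inverse.
\<close>

lemma fact_fps_inv:
  "fps_inv fact_fps oo fact_fps = fps_X" "fact_fps oo fps_inv fact_fps = fps_X"
  by (simp_all add: fact_fps_def fps_inv fps_inv_right)

definition com_seq :: "nat \<Rightarrow> complex" where
  "com_seq n = fps_nth (fps_inv fact_fps) n"

text \<open>
  \<open>P_recursive_from m a\<close> concerns the sequence \<open>a m, a (m + 1), \<dots>\<close>: the values \<open>a n\<close> with \<open>n < m\<close>
  play no role, and the recurrence is required for every \<open>n \<ge> m\<close>.
\<close>

definition P_recursive_from :: "nat \<Rightarrow> (nat \<Rightarrow> complex) \<Rightarrow> bool" where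
  "P_recursive_from m a \<longleftrightarrow>
     (\<exists>(d :: nat) (p :: nat \<Rightarrow> complex poly). p d \<noteq> 0 \<and>
        (\<forall>n\<ge>m. (\<Sum>i\<le>d. poly (p i) (of_nat n) * a (n + i)) = 0))"

end

theory Submission
  imports Defs "HOL-Library.FuncSet" "HOL-Computational_Algebra.Polynomial_FPS"
begin

text \<open>
  Write \<open>F = \<Sum>k\<ge>1. k! x^k\<close>, \<open>E = 1 + F\<close>, \<open>\<theta> = x d/dx\<close>, and let \<open>C\<close> be the compositional
  inverse of \<open>F\<close>. Let \<open>I\<close> and \<open>S\<close> be the generating functions of the nonempty plus indecomposable
  permutations and of the simple permutations of length at least 4.

  A P-recursive sequence has a generating function \<open>A\<close> that satisfies a linear equation
  \<open>\<Sum>k\<le>d. q_k(x) \<theta>^k A = r(x)\<close> with polynomial coefficients. Suppose that \<open>A\<close> also satisfies a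
  nonlinear equation of first order, \<open>\<theta> A = R(x, A)\<close> with \<open>R\<close> rational. Then every \<open>\<theta>^k A\<close> is a rational
  function of \<open>x\<close> and \<open>A\<close>, and the linear equation becomes an algebraic relation between \<open>x\<close> and
  \<open>A\<close>. The relation is nontrivial as soon as the complexity of these rational functions grows
  strictly with \<open>k\<close>, so that the terms cannot cancel. This happens in both cases of interest:

  \<^item> \<open>G = 1 - I = 1/E\<close> satisfies a Riccati equation, and \<open>x^k \<theta>^k G\<close> is a polynomial in \<open>G\<close> of degree
    exactly \<open>k + 1\<close> (\<open>XD_powers_reciprocal\<close>);
  \<^item> \<open>(x - (1 + x) C) \<theta> C = x C^2\<close>, and for \<open>k \<ge> 1\<close>, \<open>\<theta>^k C\<close>, as a rational function in \<open>C\<close>,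
    has a pole of order exactly \<open>2 k - 1\<close> at \<open>C = x / (1 + x)\<close> (\<open>XD_powers_inverse\<close>).

  So if \<open>I\<close> or \<open>C\<close> came from a P-recursive sequence, then it would be algebraic, and with it \<open>E\<close>. But
  \<open>E\<close> is transcendental (\<open>fact_fps_transcendental\<close>): its equation \<open>x \<theta> E = (1 - x) E - 1\<close> is linear of
  first order, which forces an algebraic \<open>E\<close> to be rational, and factorials grow too fast for that.

  The simple permutations reduce to \<open>C\<close>. A permutation of length at least 2 that is decomposable
  neither into a direct nor into a skew sum has pairwise disjoint maximal proper blocks; contracting
  them gives a simple permutation of length at least 4, and the permutation is recovered from this
  simple permutation and the patterns inside the blocks. With
  \<open>I = F / (1 + F)\<close> this gives \<open>2 I - F = x + S(F)\<close>; substituting \<open>C\<close> for \<open>x\<close> gives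
  \<open>C = 2 x / (1 + x) - x - S\<close>, and a rational summand does not affect the existence of a linear
  differential equation.
\<close>

section \<open>Polynomial expressions in a power series\<close>

text \<open>
  The inner polynomials stay polynomials in \<open>x\<close>; only the outer variable is replaced by the series.
\<close>

definition poly_at :: "complex poly poly \<Rightarrow> complex fps \<Rightarrow> complex fps" where
  "poly_at P H = poly (map_poly fps_of_poly P) H"

lemma poly_at_0 [simp]: "poly_at 0 H = 0"
  by (simp add: poly_at_def)

lemma poly_at_pCons [simp]: "poly_at (pCons a P) H = fps_of_poly a + H * poly_at P H"
  by (simp add: poly_at_def map_poly_pCons)

lemma poly_at_1 [simp]: "poly_at 1 H = 1"
  by (simp add: one_pCons)

lemma poly_at_add [simp]: "poly_at (P + Q) H = poly_at P H + poly_at Q H"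
  by (induction P Q rule: poly_induct2) (simp_all add: fps_of_poly_add algebra_simps)

lemma poly_at_smult [simp]: "poly_at (smult a P) H = fps_of_poly a * poly_at P H"
  by (induction P) (simp_all add: fps_of_poly_mult algebra_simps)

lemma poly_at_minus [simp]: "poly_at (- P) H = - poly_at P H"
  using poly_at_smult[of "-1" P H] by (simp add: fps_of_poly_uminus)

lemma poly_at_diff [simp]: "poly_at (P - Q) H = poly_at P H - poly_at Q H"
  using poly_at_add[of P "- Q" H] by simp

lemma poly_at_mult [simp]: "poly_at (P * Q) H = poly_at P H * poly_at Q H"
  by (induction P) (simp_all add: algebra_simps)

lemma poly_at_power [simp]: "poly_at (P ^ n) H = poly_at P H ^ n"
  by (induction n) simp_all

lemma poly_at_sum [simp]: "poly_at (sum f A) H = (\<Sum>x\<in>A. poly_at (f x) H)"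
  by (induction A rule: infinite_finite_induct) simp_all

lemma poly_at_altdef:
  assumes "degree P \<le> n"
  shows "poly_at P H = (\<Sum>i\<le>n. fps_of_poly (coeff P i) * H ^ i)"
proof -
  have "poly_at (monom a i) H = fps_of_poly a * H ^ i" for a i
    by (induction i) (simp_all add: monom_0 monom_Suc mult_ac)
  moreover have "P = (\<Sum>i\<le>n. monom (coeff P i) i)"
    using assms by (simp add: poly_as_sum_of_monoms')
  ultimately show ?thesis
    by (metis (no_types, lifting) poly_at_sum sum.cong)
qed

lemma poly_at_pcompose [simp]: "poly_at (pcompose P Q) H = poly_at P (poly_at Q H)"
  by (induction P) (simp_all add: pcompose_pCons)

definition poly_XD :: "complex poly \<Rightarrow> complex poly" where
  "poly_XD p = pCons 0 (pderiv p)"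

lemma fps_XD_mult: "fps_XD (f * g) = fps_XD f * g + f * fps_XD (g :: complex fps)"
  by (simp add: fps_XD_def algebra_simps)

lemma fps_XD_diff: "fps_XD (f - g) = fps_XD f - fps_XD (g :: complex fps)"
  by (simp add: fps_XD_def algebra_simps)

lemma fps_XD_power_Suc:
  "fps_XD (f ^ Suc n) = of_nat (Suc n) * f ^ n * fps_XD (f :: complex fps)"
  by (induction n) (simp_all add: fps_XD_mult algebra_simps)

lemma fps_XD_X: "fps_XD fps_X = (fps_X :: complex fps)"
  by (simp add: fps_XD_def)

lemma fps_XD_1: "fps_XD 1 = (0 :: complex fps)"
  by (simp add: fps_XD_def)

lemma fps_of_poly_XD: "fps_of_poly (poly_XD p) = fps_XD (fps_of_poly p)"
  by (simp add: poly_XD_def fps_of_poly_pCons fps_of_poly_pderiv fps_XD_def mult.commute)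

lemma poly_XD_0 [simp]: "poly_XD 0 = 0"
  by (simp add: poly_XD_def)

lemma fps_XD_poly_at:
  "fps_XD (poly_at P H) = poly_at (map_poly poly_XD P) H + poly_at (pderiv P) H * fps_XD H"
  by (induction P) (simp_all add: map_poly_pCons fps_XD_mult fps_of_poly_XD pderiv_pCons
      algebra_simps, simp add: fps_XD_def)

text \<open>
  Algebraic over the field of rational functions; clearing denominators makes polynomial
  coefficients sufficient.
\<close>

definition algebraic_fps :: "complex fps \<Rightarrow> bool" where
  "algebraic_fps H \<longleftrightarrow> (\<exists>P. P \<noteq> 0 \<and> poly_at P H = 0)"

section \<open>The factorial series is transcendental\<close>

lemma fact_fps_nth: "fps_nth (1 + fact_fps) n = fact n"
  by (simp add: fact_fps_def)

text \<open>
  If \<open>a\<close> starts with \<open>a_j x^j\<close>, then the coefficients of the product are dominated by \<open>a_j (n - j)!\<close>,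
  because \<open>(n - i)!\<close> is smaller by a factor of at least \<open>n - j\<close> for every \<open>i > j\<close>. So they do not
  vanish for large \<open>n\<close>.
\<close>

lemma fact_fps_not_rational:
  assumes "a \<noteq> 0"
  shows "fps_of_poly a * (1 + fact_fps) \<noteq> fps_of_poly w"
proof
  assume eq: "fps_of_poly a * (1 + fact_fps) = fps_of_poly w"
  define j where "j = (LEAST j. coeff a j \<noteq> 0)"
  have j: "coeff a j \<noteq> 0"
    unfolding j_def by (rule LeastI[of _ "degree a"]) (use assms in simp)
  have below: "coeff a i = 0" if "i < j" for i
    using not_less_Least[of i "\<lambda>j. coeff a j \<noteq> 0"] that by (auto simp: j_def)
  define S where "S = (\<Sum>i\<in>{j<..degree a}. cmod (coeff a i))"
  obtain t where t: "S < real t * cmod (coeff a j)"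
    using reals_Archimedean3[of "cmod (coeff a j)"] j by auto
  define n where "n = t + degree a + degree w + j + 1"
  have j_le: "j \<le> degree a"
    using j le_degree by blast
  have "0 = fps_nth (fps_of_poly a * (1 + fact_fps)) n"
    by (simp add: eq n_def coeff_eq_0)
  also have "\<dots> = (\<Sum>i=0..n. coeff a i * fact (n - i))"
    unfolding fps_mult_nth fact_fps_nth by simp
  also have "\<dots> = (\<Sum>i\<in>insert j {j<..degree a}. coeff a i * fact (n - i))"
  proof (intro sum.mono_neutral_right ballI)
    fix i assume "i \<in> {0..n} - insert j {j<..degree a}"
    hence "i < j \<or> degree a < i" by auto
    thus "coeff a i * fact (n - i) = 0"
      using below coeff_eq_0[of a i] by auto
  qed (use j_le in \<open>auto simp: n_def\<close>)
  also have "\<dots> = coeff a j * fact (n - j) + (\<Sum>i\<in>{j<..degree a}. coeff a i * fact (n - i))"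
    by simp
  finally have "coeff a j * fact (n - j) = - (\<Sum>i\<in>{j<..degree a}. coeff a i * fact (n - i))"
    by (simp add: eq_neg_iff_add_eq_0)
  hence "cmod (coeff a j) * fact (n - j) = cmod (\<Sum>i\<in>{j<..degree a}. coeff a i * fact (n - i))"
    by (metis norm_minus_cancel norm_mult norm_fact)
  also have "\<dots> \<le> (\<Sum>i\<in>{j<..degree a}. cmod (coeff a i) * fact (n - i))"
    by (rule order.trans[OF norm_sum]) (simp add: norm_mult)
  also have "\<dots> \<le> (\<Sum>i\<in>{j<..degree a}. cmod (coeff a i) * fact (n - j - 1))"
    by (intro sum_mono mult_left_mono fact_mono) auto
  also have "\<dots> = S * fact (n - j - 1)"
    by (simp add: S_def sum_distrib_right)
  also have "\<dots> < (real t * cmod (coeff a j)) * fact (n - j - 1)"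
    using t by (intro mult_strict_right_mono) auto
  also have "\<dots> \<le> (real (n - j) * cmod (coeff a j)) * fact (n - j - 1)"
    by (intro mult_right_mono) (auto simp: n_def)
  also have "\<dots> = cmod (coeff a j) * fact (n - j)"
    using fact_reduce[of "n - j", where ?'a = real] by (simp add: n_def mult_ac)
  finally show False by simp
qed

text \<open>
  Coefficientwise this is the recurrence \<open>n! = n (n - 1)!\<close>.
\<close>

lemma fact_fps_ode:
  "fps_X * fps_XD (1 + fact_fps) = (1 - fps_X) * (1 + fact_fps) - 1"
proof (rule fps_ext)
  fix n
  show "fps_nth (fps_X * fps_XD (1 + fact_fps)) n =
    fps_nth ((1 - fps_X) * (1 + fact_fps) - 1) n"
    by (cases n; cases "n - 1")
      (simp_all add: fact_fps_def fps_XD_def left_diff_distrib algebra_simps)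
qed

lemma fps_XD_wronskian_nth:
  fixes f g :: "complex fps"
  assumes "m < subdegree f + subdegree g"
  shows "fps_nth (f * fps_XD g) m = 0"
  unfolding fps_mult_nth
proof (rule sum.neutral, safe)
  fix i assume i: "i \<in> {0..m}"
  show "fps_nth f i * fps_nth (fps_XD g) (m - i) = 0"
  proof (cases "i < subdegree f")
    case False
    hence "m - i < subdegree g" using assms i by auto
    thus ?thesis by (cases "m - i") (auto simp: fps_XD_def)
  qed auto
qed

text \<open>
  The hypothesis says that \<open>w = g / f\<close> solves \<open>x \<theta> w = (1 - x) w\<close>, the homogeneous form of the equation
  of \<open>fact_fps_ode\<close>. It has no nonzero Laurent series solution (its solutions are the multiples of
  \<open>exp (- 1 / x) / x\<close>): the factor \<open>x\<close> makes the lowest term on the right impossible on the left.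
\<close>

lemma fps_wronskian_ode_imp_0:
  fixes f g :: "complex fps"
  assumes "fps_X * (f * fps_XD g - fps_XD f * g) = (1 - fps_X) * (f * g)" "f \<noteq> 0"
  shows "g = 0"
proof (rule ccontr)
  assume g: "g \<noteq> 0"
  let ?n = "subdegree f + subdegree g"
  have sd: "subdegree (f * g) = ?n"
    using assms(2) g by (simp add: subdegree_mult)
  have "fps_nth ((1 - fps_X) * (f * g)) ?n = fps_nth (f * g) ?n"
  proof (cases ?n)
    case (Suc l)
    hence "fps_nth (f * g) l = 0"
      using sd by (intro nth_less_subdegree_zero) simp
    thus ?thesis
      using Suc by (simp add: left_diff_distrib)
  qed (simp add: left_diff_distrib)
  moreover have "fps_nth (f * g) ?n \<noteq> 0"
    using sd assms(2) g by (metis mult_eq_0_iff nth_subdegree_nonzero)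
  moreover have "fps_nth (fps_X * (f * fps_XD g - fps_XD f * g)) ?n = 0"
    using fps_XD_wronskian_nth[of "?n - 1" f g] fps_XD_wronskian_nth[of "?n - 1" g f]
    by (cases ?n) (auto simp: mult.commute)
  ultimately show False
    by (simp add: assms(1))
qed

lemma fps_of_poly_of_nat: "fps_of_poly (of_nat n) = of_nat n"
  by (induction n) (simp_all add: fps_of_poly_add)

lemma fps_of_poly_1_minus_X: "fps_of_poly [:1, - 1:] = (1 - fps_X :: complex fps)"
  by (rule fps_ext) (auto simp: coeff_pCons split: nat.splits)

text \<open>
  Let \<open>P\<close>, of degree \<open>m = l + 1\<close>, be a polynomial of minimal degree that annihilates \<open>E\<close>. Since the
  equation of \<open>E\<close> is linear, applying \<open>x \<theta>\<close> to \<open>P(E) = 0\<close> gives another annihilating polynomial of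
  degree at most \<open>m\<close>, which must be proportional to \<open>P\<close>. Comparing the two highest coefficients
  shows that the mean of the conjugates of \<open>E\<close>, which is the rational function
  \<open>- p_l / (m p_m)\<close>, satisfies the same equation as \<open>E\<close>. The difference of the two solves the
  homogeneous equation, so \<open>E\<close> is rational.
\<close>

theorem fact_fps_transcendental: "\<not> algebraic_fps (1 + fact_fps)"
proof
  let ?E = "1 + fact_fps"
  assume "algebraic_fps ?E"
  then obtain P0 where P0: "P0 \<noteq> 0 \<and> poly_at P0 ?E = 0"
    by (auto simp: algebraic_fps_def)
  obtain P where P: "P \<noteq> 0" "poly_at P ?E = 0"
    and min: "\<And>R. R \<noteq> 0 \<Longrightarrow> poly_at R ?E = 0 \<Longrightarrow> degree P \<le> degree R"
    using ex_has_least_nat[of "\<lambda>P. P \<noteq> 0 \<and> poly_at P ?E = 0" P0 degree] P0 by blast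
  have "degree P \<noteq> 0"
  proof
    assume "degree P = 0"
    then obtain c where "P = [:c:]" by (rule degree_eq_zeroE)
    thus False using P fps_of_poly_eq_iff[of c 0] by simp
  qed
  then obtain l where l: "degree P = Suc l" by (cases "degree P") auto
  define c :: "complex poly" where "c = [:1, - 1:]"
  have fps_c: "fps_of_poly c = 1 - fps_X"
    unfolding c_def by (rule fps_of_poly_1_minus_X)
  \<comment> \<open>\<open>Q(E)\<close> is \<open>x \<theta> (P(E))\<close> with \<open>x \<theta> E\<close> replaced by \<open>(1 - x) E - 1\<close>.\<close>
  define Q where "Q = smult [:0, 1:] (map_poly poly_XD P) + pderiv P * [:- 1, c:]"
  have "poly_at Q ?E = fps_X * poly_at (map_poly poly_XD P) ?E +
      poly_at (pderiv P) ?E * ((1 - fps_X) * ?E - 1)"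
    by (simp add: Q_def fps_of_poly_uminus fps_c fps_of_poly_fps_X
        algebra_simps)
  also have "\<dots> = fps_X * fps_XD (poly_at P ?E)"
    unfolding fps_XD_poly_at fact_fps_ode[symmetric] by (simp only: distrib_left mult_ac)
  finally have Q_ann: "poly_at Q ?E = 0"
    by (simp add: P fps_XD_def)
  have coeff_Q: "coeff Q i = [:0, 1:] * poly_XD (coeff P i) - of_nat (Suc i) * coeff P (Suc i)
      + of_nat i * c * coeff P i" for i
    by (cases i) (simp_all add: Q_def coeff_map_poly coeff_pderiv mult_ac)
  define R where "R = smult (coeff P (Suc l)) Q - smult (coeff Q (Suc l)) P"
  have "coeff R i = 0" if "l < i" for i
    using that by (cases "i = Suc l") (simp_all add: R_def coeff_Q coeff_eq_0 l)
  hence "degree R \<le> l"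
    by (simp add: degree_le)
  moreover have "poly_at R ?E = 0"
    by (simp add: R_def P Q_ann)
  ultimately have "R = 0"
    using min[of R] l by force
  define a where "a = fps_of_poly (coeff P (Suc l))"
  define b where "b = fps_of_poly (coeff P l)"
  have c0: "coeff P (Suc (Suc l)) = 0"
    by (simp add: l coeff_eq_0)
  have "a * (fps_X * fps_XD b - of_nat (Suc l) * a + of_nat l * (1 - fps_X) * b) -
      (fps_X * fps_XD a - of_nat (Suc (Suc l)) * 0 + of_nat (Suc l) * (1 - fps_X) * a) * b =
      fps_of_poly (coeff R l)"
    unfolding R_def coeff_diff coeff_smult coeff_Q c0 a_def b_def
    by (simp only: fps_of_poly_diff fps_of_poly_mult fps_of_poly_add fps_of_poly_0
        fps_of_poly_XD fps_of_poly_of_nat fps_of_poly_fps_X fps_c)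
  also have "\<dots> = 0"
    using \<open>R = 0\<close> by simp
  finally have rel: "a * (fps_X * fps_XD b - of_nat (Suc l) * a + of_nat l * (1 - fps_X) * b) =
      b * (fps_X * fps_XD a + of_nat (Suc l) * (1 - fps_X) * a)"
    by (simp add: mult.commute)
  \<comment> \<open>Up to the factor \<open>m a\<close>, this is the difference of \<open>E\<close> and the mean \<open>- b / (m a)\<close>.\<close>
  define g where "g = b + of_nat (Suc l) * (a * ?E)"
  have XD_g: "fps_XD g = fps_XD b + of_nat (Suc l) * (fps_XD a * ?E + a * fps_XD ?E)"
    unfolding g_def by (simp add: fps_XD_def algebra_simps)
  have "fps_X * (a * fps_XD g - fps_XD a * g) =
      a * (fps_X * fps_XD b) - b * (fps_X * fps_XD a) + of_nat (Suc l) * a * a * (fps_X * fps_XD ?E)"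
    unfolding XD_g unfolding g_def by (simp only: algebra_simps)
  also have "a * (fps_X * fps_XD b) - b * (fps_X * fps_XD a) =
      (1 - fps_X) * a * b + of_nat (Suc l) * a * a"
    using rel by (simp add: algebra_simps)
  also have "fps_X * fps_XD ?E = (1 - fps_X) * ?E - 1"
    by (rule fact_fps_ode)
  finally have "fps_X * (a * fps_XD g - fps_XD a * g) = (1 - fps_X) * (a * g)"
    unfolding g_def by (simp add: algebra_simps del: of_nat_Suc)
  moreover have lc: "coeff P (Suc l) \<noteq> 0"
    using P(1) l by (metis leading_coeff_neq_0)
  hence "a \<noteq> 0"
    using fps_of_poly_eq_iff[of _ 0] by (auto simp: a_def)
  ultimately have "g = 0"
    by (rule fps_wronskian_ode_imp_0)
  hence "fps_of_poly (of_nat (Suc l) * coeff P (Suc l)) * ?E = fps_of_poly (- coeff P l)"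
    by (simp only: g_def a_def b_def fps_of_poly_mult fps_of_poly_of_nat fps_of_poly_uminus
        eq_neg_iff_add_eq_0 add.commute mult.assoc)
  moreover have "of_nat (Suc l) * coeff P (Suc l) \<noteq> 0"
    using lc by (simp del: of_nat_Suc)
  ultimately show False
    using fact_fps_not_rational by blast
qed

section \<open>From recurrences to linear differential equations\<close>

text \<open>
  The equation is written with \<open>\<theta> = x d/dx\<close> because \<open>\<theta>\<close> multiplies the coefficient of \<open>x^n\<close> by \<open>n\<close>, which
  makes the translation of recurrences direct; since \<open>x^k (d/dx)^k\<close> is a polynomial in \<open>\<theta>\<close> of degree
  \<open>k\<close>, powers of \<open>d/dx\<close> would define the same class of series. A polynomial right-hand side absorbs
  finitely many exceptional coefficients.
\<close>

definition dfinite :: "complex fps \<Rightarrow> bool" where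
  "dfinite A \<longleftrightarrow> (\<exists>d q r. q d \<noteq> 0 \<and>
     (\<Sum>k\<le>d. fps_of_poly (q k) * (fps_XD ^^ k) A) = fps_of_poly r)"

lemma dfiniteI:
  assumes "k0 \<le> K" "q k0 \<noteq> 0"
    and eq: "(\<Sum>k\<le>K. fps_of_poly (q k) * (fps_XD ^^ k) A) = fps_of_poly r"
  shows "dfinite A"
proof -
  define d where "d = Max {k. k \<le> K \<and> q k \<noteq> 0}"
  have fin: "finite {k. k \<le> K \<and> q k \<noteq> 0}" by simp
  have d: "d \<le> K" "q d \<noteq> 0"
    using Max_in[OF fin] assms(1,2) unfolding d_def by blast+
  have above: "q k = 0" if "k \<le> K" "d < k" for k
    
  proof (rule ccontr)
    assume "q k \<noteq> 0"
    hence "k \<le> d"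
      unfolding d_def using that by (intro Max_ge fin) simp
    thus False using that by simp
  qed
  have "(\<Sum>k\<le>K. fps_of_poly (q k) * (fps_XD ^^ k) A) =
      (\<Sum>k\<le>d. fps_of_poly (q k) * (fps_XD ^^ k) A)"
    using d(1) above by (intro sum.mono_neutral_right) (auto simp: not_le)
  thus ?thesis
    using d(2) eq unfolding dfinite_def by metis
qed

text \<open>
  The coefficient of \<open>x^(n + d)\<close> in \<open>\<Sum>i\<le>d. x^(d - i) p_i(\<theta> - i) A\<close> is \<open>\<Sum>i\<le>d. p_i(n) a_(n + i)\<close>, so
  the recurrence makes this series a polynomial. The operator is not zero, since the terms with
  \<open>i < d\<close> are divisible by \<open>x\<close> and the term with \<open>i = d\<close> is not.
\<close>

lemma P_recursive_imp_dfinite: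
  assumes "P_recursive_from m a" and ev: "\<And>n. N \<le> n \<Longrightarrow> fps_nth A n = a n"
  shows "dfinite A"
proof -
  obtain d p where p: "p d \<noteq> 0"
    and rec: "\<And>n. m \<le> n \<Longrightarrow> (\<Sum>i\<le>d. poly (p i) (of_nat n) * a (n + i)) = 0"
    using assms(1) unfolding P_recursive_from_def by blast
  define s where "s i = pcompose (p i) [:- of_nat i, 1:]" for i
  define K where "K = (\<Sum>i\<le>d. degree (s i))"
  have deg_s: "degree (s i) \<le> K" if "i \<le> d" for i
    unfolding K_def using that by (intro member_le_sum) auto
  have poly_s: "poly (s i) (of_nat (n + i)) = poly (p i) (of_nat n)" for i n
    by (simp add: s_def poly_pcompose)
  define q where "q k = (\<Sum>i\<le>d. monom (coeff (s i) k) (d - i))" for k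
  have "s d \<noteq> 0"
    using p by (simp add: s_def pcompose_eq_0_iff)
  have "coeff (q (degree (s d))) 0 = (\<Sum>i\<in>{d}. coeff (s i) (degree (s d)))"
    unfolding q_def coeff_sum coeff_monom by (intro sum.mono_neutral_cong_right) auto
  hence q_nz: "q (degree (s d)) \<noteq> 0"
    using \<open>s d \<noteq> 0\<close> by auto
  define B where "B = (\<Sum>k\<le>K. fps_of_poly (q k) * (fps_XD ^^ k) A)"
  have "fps_nth B n = 0" if n: "m + N + d \<le> n" for n
  proof -
    define n' where "n' = n - d"
    have n': "n = n' + d" "m \<le> n'" "N \<le> n'"
      using n by (auto simp: n'_def)
    have "fps_nth (fps_of_poly (q k) * (fps_XD ^^ k) A) n =
        (\<Sum>i\<le>d. coeff (s i) k * of_nat (n' + i) ^ k * a (n' + i))" for k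
    proof -
      have "fps_nth (fps_of_poly (monom c (d - i)) * f) n = c * fps_nth f (n' + i)"
        if "i \<le> d" for c i and f :: "complex fps"
        using that n' by (simp add: fps_of_poly_monom mult.assoc fps_X_power_mult_nth)
      thus ?thesis
        using n'(3) by (simp add: q_def fps_of_poly_sum sum_distrib_right fps_sum_nth
            fps_mult_fps_XD_shift ev mult.assoc)
    qed
    hence "fps_nth B n = (\<Sum>i\<le>d. \<Sum>k\<le>K. coeff (s i) k * of_nat (n' + i) ^ k * a (n' + i))"
      unfolding B_def fps_sum_nth by (simp only: sum.swap[of _ "{..K}"])
    also have "\<dots> = (\<Sum>i\<le>d. poly (s i) (of_nat (n' + i)) * a (n' + i))"
    proof (intro sum.cong refl)
      fix i assume "i \<in> {..d}"
      hence "poly (s i) x = (\<Sum>k\<le>K. coeff (s i) k * x ^ k)" for x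
        unfolding poly_altdef using deg_s[of i]
        by (intro sum.mono_neutral_left) (auto simp: coeff_eq_0)
      thus "(\<Sum>k\<le>K. coeff (s i) k * of_nat (n' + i) ^ k * a (n' + i)) =
          poly (s i) (of_nat (n' + i)) * a (n' + i)"
        by (simp only: sum_distrib_right)
    qed
    also have "\<dots> = 0"
      unfolding poly_s using rec[OF n'(2)] by simp
    finally show ?thesis .
  qed
  hence "B = fps_of_poly (truncate_fps (m + N + d) B)"
    unfolding fps_of_poly_truncate by (intro fps_ext) auto
  thus ?thesis
    unfolding B_def by (rule dfiniteI[where q = q, OF deg_s[OF order.refl] q_nz])
qed

lemma XD_power_of_rational:
  fixes R :: "complex fps"
  assumes "(1 + fps_X) * R = fps_of_poly w"
  shows "\<exists>w. (1 + fps_X) ^ Suc k * (fps_XD ^^ k) R = fps_of_poly w"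
proof (induction k)
  case 0
  show ?case using assms by auto
next
  case (Suc k)
  then obtain v where v: "(1 + fps_X) ^ Suc k * (fps_XD ^^ k) R = fps_of_poly v"
    by blast
  let ?Y = "(fps_XD ^^ k) R"
  have "fps_of_poly (poly_XD v) = fps_XD ((1 + fps_X) ^ Suc k * ?Y)"
    by (simp only: v fps_of_poly_XD)
  also have "\<dots> = of_nat (Suc k) * (1 + fps_X) ^ k * fps_X * ?Y + (1 + fps_X) ^ Suc k * fps_XD ?Y"
    unfolding fps_XD_mult fps_XD_power_Suc fps_XD_add fps_XD_1 fps_XD_X by simp
  finally have "(1 + fps_X) ^ Suc (Suc k) * fps_XD ?Y =
      (1 + fps_X) * fps_of_poly (poly_XD v) - of_nat (Suc k) * fps_X * ((1 + fps_X) ^ Suc k * ?Y)"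
    by (simp add: algebra_simps)
  also have "\<dots> = fps_of_poly ([:1, 1:] * poly_XD v - of_nat (Suc k) * [:0, 1:] * v)"
    by (simp only: v fps_of_poly_diff fps_of_poly_mult fps_of_poly_of_nat fps_of_poly_fps_X
        fps_of_poly_linear' fps_const_1_eq_1 mult_1)
  finally show ?case by auto
qed

text \<open>
  Applying \<open>\<theta>^k\<close> to \<open>R\<close> leaves only a power of \<open>1 + x\<close> in the denominator, so multiplication of the
  equation by one high power of \<open>1 + x\<close> makes the contribution of \<open>R\<close> a polynomial.
\<close>

lemma dfinite_rational_diff:
  assumes "dfinite A" "(1 + fps_X) * R = fps_of_poly w"
  shows "dfinite (R - A)"
proof -
  obtain d q r where q: "q d \<noteq> 0"
    and eq: "(\<Sum>k\<le>d. fps_of_poly (q k) * (fps_XD ^^ k) A) = fps_of_poly r"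
    using assms(1) unfolding dfinite_def by blast
  obtain v where v: "\<And>k. (1 + fps_X) ^ Suc k * (fps_XD ^^ k) R = fps_of_poly (v k)"
    using XD_power_of_rational[OF assms(2)] by metis
  define u :: "complex poly" where "u = [:1, 1:]"
  have u: "fps_of_poly u = 1 + fps_X" "u \<noteq> 0"
    by (simp_all add: u_def fps_of_poly_linear')
  have diff: "(fps_XD ^^ k) (R - A) = (fps_XD ^^ k) R - (fps_XD ^^ k) A" for k
    by (induction k) (simp_all add: fps_XD_diff)
  have "(\<Sum>k\<le>d. fps_of_poly (u ^ Suc d * q k) * (fps_XD ^^ k) (R - A)) =
      (\<Sum>k\<le>d. fps_of_poly (q k) * ((1 + fps_X) ^ Suc d * (fps_XD ^^ k) R)) -
      (1 + fps_X) ^ Suc d * (\<Sum>k\<le>d. fps_of_poly (q k) * (fps_XD ^^ k) A)"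
    unfolding sum_distrib_left sum_subtractf[symmetric] fps_of_poly_mult fps_of_poly_power u(1)
  proof (intro sum.cong refl)
    fix k
    have "U * Q * (Y - Z) = Q * (U * Y) - U * (Q * Z)" for U Q Y Z :: "complex fps"
      by (simp add: algebra_simps)
    thus "(1 + fps_X) ^ Suc d * fps_of_poly (q k) * (fps_XD ^^ k) (R - A) =
        fps_of_poly (q k) * ((1 + fps_X) ^ Suc d * (fps_XD ^^ k) R) -
        (1 + fps_X) ^ Suc d * (fps_of_poly (q k) * (fps_XD ^^ k) A)"
      by (simp only: diff)
  qed
  also have "(\<Sum>k\<le>d. fps_of_poly (q k) * ((1 + fps_X) ^ Suc d * (fps_XD ^^ k) R)) =
      (\<Sum>k\<le>d. fps_of_poly (q k * (u ^ (d - k) * v k)))"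
  proof (intro sum.cong refl)
    fix k assume "k \<in> {..d}"
    hence "(1 + fps_X :: complex fps) ^ Suc d = (1 + fps_X) ^ (d - k) * (1 + fps_X) ^ Suc k"
      by (simp only: power_add[symmetric]) simp
    thus "fps_of_poly (q k) * ((1 + fps_X) ^ Suc d * (fps_XD ^^ k) R) =
        fps_of_poly (q k * (u ^ (d - k) * v k))"
      by (simp only: fps_of_poly_mult fps_of_poly_power u(1) v mult.assoc)
  qed
  also have "\<dots> - (1 + fps_X) ^ Suc d * (\<Sum>k\<le>d. fps_of_poly (q k) * (fps_XD ^^ k) A) =
      fps_of_poly ((\<Sum>k\<le>d. q k * (u ^ (d - k) * v k)) - u ^ Suc d * r)"
    by (simp only: eq fps_of_poly_diff fps_of_poly_sum fps_of_poly_mult fps_of_poly_power u(1))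
  finally have eq': "(\<Sum>k\<le>d. fps_of_poly (u ^ Suc d * q k) * (fps_XD ^^ k) (R - A)) =
      fps_of_poly ((\<Sum>k\<le>d. q k * (u ^ (d - k) * v k)) - u ^ Suc d * r)" .
  have "u ^ Suc d * q d \<noteq> 0"
    using q u(2) by simp
  from dfiniteI[where q = "\<lambda>k. u ^ Suc d * q k", OF order.refl this eq']
  show ?thesis .
qed

section \<open>D-finite solutions of two nonlinear first-order equations are algebraic\<close>

text \<open>
  The Riccati equation is quadratic in \<open>G\<close>: each application of \<open>x \<theta>\<close> turns the leading term
  \<open>k! G^(k + 1)\<close> into \<open>k! (k + 1) G^k G^2\<close>, and nothing else reaches this degree.
\<close>

lemma XD_powers_reciprocal:
  assumes ode: "fps_X * fps_XD G = G ^ 2 - (1 - fps_X) * G"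
  shows "\<exists>N. degree N \<le> Suc k \<and> coeff N (Suc k) = fact k \<and>
    poly_at N G = fps_X ^ k * (fps_XD ^^ k) G"
proof (induction k)
  case 0
  show ?case
    by (rule exI[of _ "[:0, 1:]"]) simp
next
  case (Suc k)
  then obtain N where N: "degree N \<le> Suc k" "coeff N (Suc k) = fact k"
    "poly_at N G = fps_X ^ k * (fps_XD ^^ k) G" by blast
  define c :: "complex poly" where "c = [:1, - 1:]"
  have fps_c: "fps_of_poly c = 1 - fps_X"
    unfolding c_def by (rule fps_of_poly_1_minus_X)
  \<comment> \<open>The last summand corrects for the derivative of the factor \<open>x^k\<close>.\<close>
  define N' where "N' = smult [:0, 1:] (map_poly poly_XD N)
      + pderiv N * [:0, - c, 1:] - smult (of_nat k) (smult [:0, 1:] N)"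
  let ?Y = "(fps_XD ^^ k) G"
  have coeff_N': "coeff N' (Suc (Suc i)) = [:0, 1:] * poly_XD (coeff N (Suc (Suc i)))
      - c * coeff (pderiv N) (Suc i) + coeff (pderiv N) i
      - of_nat k * ([:0, 1:] * coeff N (Suc (Suc i)))" for i
    by (simp add: N'_def coeff_map_poly del: smult_smult mult_pCons_left)
  have "coeff N' i = 0" if i: "Suc (Suc k) < i" for i
  proof -
    obtain j where "i = Suc (Suc j)" "k < j"
      using i by (metis Suc_less_eq Suc_lessE)
    thus ?thesis
      using N(1) by (simp add: coeff_N' coeff_pderiv coeff_eq_0)
  qed
  moreover have "coeff N' (Suc (Suc k)) = coeff (pderiv N) k"
    using N(1) by (simp add: coeff_N' coeff_pderiv coeff_eq_0)
  ultimately have "degree N' \<le> Suc (Suc k)" "coeff N' (Suc (Suc k)) = fact (Suc k)"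
    using N(2) by (auto simp: degree_le coeff_pderiv)
  moreover have "poly_at N' G = fps_X ^ Suc k * (fps_XD ^^ Suc k) G"
  proof -
    have "poly_at N' G = fps_X * (poly_at (map_poly poly_XD N) G + poly_at (pderiv N) G * fps_XD G)
        - of_nat k * fps_X * poly_at N G"
      unfolding distrib_left mult.left_commute[of fps_X "poly_at (pderiv N) G"] ode
      by (simp only: N'_def poly_at_add poly_at_diff poly_at_mult poly_at_smult poly_at_pCons
          poly_at_0 fps_of_poly_uminus fps_c fps_of_poly_fps_X fps_of_poly_of_nat
          fps_of_poly_0 fps_of_poly_1 power2_eq_square) (simp add: algebra_simps)
    also have "\<dots> = fps_X * fps_XD (fps_X ^ k * ?Y) - of_nat k * fps_X * (fps_X ^ k * ?Y)"
      by (simp only: fps_XD_poly_at[symmetric] N(3))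
    also have "\<dots> = fps_X ^ Suc k * fps_XD ?Y"
    proof (cases k)
      case (Suc j)
      show ?thesis
        unfolding Suc fps_XD_mult fps_XD_power_Suc fps_XD_X by (simp add: algebra_simps)
    qed simp
    finally show ?thesis by simp
  qed
  ultimately show ?case by blast
qed

text \<open>
  Only the term of order \<open>d\<close> contributes to the coefficient of \<open>G^(d + 1)\<close>, so the algebraic relation
  obtained from the linear equation is not trivial.
\<close>

lemma dfinite_reciprocal_imp_algebraic:
  assumes ode: "fps_X * fps_XD G = G ^ 2 - (1 - fps_X) * G" and "dfinite G"
  shows "algebraic_fps G"
proof -
  obtain d q r where q: "q d \<noteq> 0"
    and eq: "(\<Sum>k\<le>d. fps_of_poly (q k) * (fps_XD ^^ k) G) = fps_of_poly r"
    using assms(2) unfolding dfinite_def by blast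
  obtain N where N: "\<And>k. degree (N k) \<le> Suc k" "\<And>k. coeff (N k) (Suc k) = fact k"
    "\<And>k. poly_at (N k) G = fps_X ^ k * (fps_XD ^^ k) G"
    using XD_powers_reciprocal[OF ode] by metis
  define P where "P = (\<Sum>k\<le>d. smult (q k * [:0, 1:] ^ (d - k)) (N k)) - [:[:0, 1:] ^ d * r:]"
  have "coeff P (Suc d) = (\<Sum>k\<in>{d}. q k * [:0, 1:] ^ (d - k) * coeff (N k) (Suc d))"
    unfolding P_def coeff_diff coeff_sum coeff_smult coeff_pCons_Suc coeff_0 diff_zero
  proof (intro sum.mono_neutral_right ballI)
    fix k assume "k \<in> {..d} - {d}"
    hence "degree (N k) < Suc d"
      using N(1)[of k] by auto
    thus "q k * [:0, 1:] ^ (d - k) * coeff (N k) (Suc d) = 0"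
      by (simp add: coeff_eq_0)
  qed auto
  hence "coeff P (Suc d) \<noteq> 0"
    using q N(2) by simp
  moreover have "poly_at P G = 0"
  proof -
    have "poly_at P G = (\<Sum>k\<le>d. fps_of_poly (q k) * (fps_X ^ (d - k) * fps_X ^ k) * (fps_XD ^^ k) G)
       - fps_X ^ d * fps_of_poly r"
      by (simp add: P_def N(3) fps_of_poly_mult fps_of_poly_power fps_of_poly_fps_X mult.assoc)
    also have "(\<Sum>k\<le>d. fps_of_poly (q k) * (fps_X ^ (d - k) * fps_X ^ k) * (fps_XD ^^ k) G) =
       (\<Sum>k\<le>d. fps_X ^ d * (fps_of_poly (q k) * (fps_XD ^^ k) G))"
      by (intro sum.cong refl) (simp add: power_add[symmetric])
    finally show ?thesis
      by (simp add: eq sum_distrib_left[symmetric])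
  qed
  ultimately show ?thesis
    unfolding algebraic_fps_def by (intro exI[of _ P]) auto
qed

text \<open>
  The reversed polynomial annihilates the reciprocal.
\<close>

lemma algebraic_reciprocal:
  assumes "algebraic_fps G" "G * E = 1"
  shows "algebraic_fps E"
proof -
  obtain P where P: "P \<noteq> 0" "poly_at P G = 0"
    using assms(1) unfolding algebraic_fps_def by blast
  have "poly_at (reflect_poly P) E =
      (\<Sum>i\<le>degree P. fps_of_poly (coeff P (degree P - i)) * E ^ i)"
    by (subst poly_at_altdef[OF degree_reflect_poly_le]) (simp add: coeff_reflect_poly)
  also have "\<dots> = (\<Sum>i\<le>degree P. fps_of_poly (coeff P i) * E ^ (degree P - i))"
    by (rule sum.reindex_bij_witness[of _ "\<lambda>i. degree P - i" "\<lambda>i. degree P - i"]) auto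
  also have "\<dots> = (\<Sum>i\<le>degree P. E ^ degree P * (fps_of_poly (coeff P i) * G ^ i))"
  proof (intro sum.cong refl)
    fix i assume "i \<in> {..degree P}"
    hence "E ^ degree P * G ^ i = E ^ (degree P - i) * (G * E) ^ i"
      by (simp add: power_mult_distrib mult_ac power_add[symmetric])
    hence "E ^ degree P * G ^ i = E ^ (degree P - i)"
      by (simp add: assms(2))
    thus "fps_of_poly (coeff P i) * E ^ (degree P - i) =
        E ^ degree P * (fps_of_poly (coeff P i) * G ^ i)"
      by (simp only: mult.left_commute[of "E ^ degree P"])
  qed
  also have "\<dots> = E ^ degree P * poly_at P G"
    by (simp add: poly_at_altdef[OF order.refl] sum_distrib_left)
  finally show ?thesis
    unfolding algebraic_fps_def using P by (intro exI[of _ "reflect_poly P"]) simp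
qed

text \<open>
  Put \<open>D = x - (1 + x) C\<close>, so that \<open>\<theta> C = x C^2 / D\<close>. Differentiating a quotient \<open>N / D^j\<close> gives the
  summand \<open>- j N \<theta> D / D^(j + 1)\<close>, and \<open>\<theta> D\<close> contains \<open>- (1 + x) x C^2 / D\<close>; thus the order of
  the pole at \<open>D = 0\<close> grows by exactly 2. The series \<open>z = x / (1 + x)\<close> is the point \<open>C = z\<close> at which
  \<open>D\<close> vanishes, and a nonzero value of the numerator there says that the order is not smaller.
\<close>

lemma XD_powers_inverse:
  assumes ode: "(fps_X - (1 + fps_X) * C) * fps_XD C = fps_X * C ^ 2"
    and z: "(1 + fps_X) * z = fps_X"
  shows "\<exists>N. poly_at N C = (fps_X - (1 + fps_X) * C) ^ Suc (2 * k) * (fps_XD ^^ Suc k) C \<and>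
    poly_at N z \<noteq> 0"
proof (induction k)
  case 0
  have "z \<noteq> 0" using z by auto
  hence "poly_at [:0, 0, [:0, 1:]:] z \<noteq> 0"
    by (simp add: fps_of_poly_fps_X)
  moreover have "poly_at [:0, 0, [:0, 1:]:] C =
      (fps_X - (1 + fps_X) * C) ^ Suc (2 * 0) * (fps_XD ^^ Suc 0) C"
    using ode by (simp add: fps_of_poly_fps_X power2_eq_square mult_ac)
  ultimately show ?case by blast
next
  case (Suc k)
  define D where "D = fps_X - (1 + fps_X) * C"
  define Y where "Y = (fps_XD ^^ Suc k) C"
  obtain N where N: "poly_at N C = D ^ Suc (2 * k) * Y" "poly_at N z \<noteq> 0"
    using Suc unfolding D_def Y_def by blast
  define x u :: "complex poly" where "x = [:0, 1:]" and "u = [:1, 1:]"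
  have xu: "fps_of_poly x = fps_X" "fps_of_poly u = 1 + fps_X"
    by (simp_all add: x_def u_def fps_of_poly_fps_X fps_of_poly_linear')
  define \<Delta> where "\<Delta> = [:x, - u:]"
  have \<Delta>_at: "poly_at \<Delta> H = fps_X - (1 + fps_X) * H" for H
    by (simp add: \<Delta>_def xu fps_of_poly_uminus algebra_simps)
  define T where "T = smult x (\<Delta> * [:1, - 1:] - smult u [:0, 0, 1:])"
  define N' where "N' = \<Delta> * \<Delta> * map_poly poly_XD N + \<Delta> * pderiv N * smult x [:0, 0, 1:]
      - of_nat (Suc (2 * k)) * T * N"
  have of_nat_at: "poly_at (of_nat n) H = of_nat n" for n H
    by (induction n) simp_all
  have T_at: "poly_at T H = fps_X * ((fps_X - (1 + fps_X) * H) * (1 - H) - (1 + fps_X) * H ^ 2)"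
    for H
    by (simp add: T_def \<Delta>_at xu fps_of_poly_uminus power2_eq_square algebra_simps)
  have N'_at: "poly_at N' H = (fps_X - (1 + fps_X) * H) * ((fps_X - (1 + fps_X) * H)
      * poly_at (map_poly poly_XD N) H + poly_at (pderiv N) H * (fps_X * H ^ 2))
      - of_nat (Suc (2 * k)) * poly_at T H * poly_at N H" for H
    unfolding N'_def poly_at_add poly_at_diff poly_at_mult \<Delta>_at of_nat_at
    by (simp add: xu power2_eq_square algebra_simps del: of_nat_Suc)
  have "poly_at N' z = of_nat (Suc (2 * k)) * (fps_X * ((1 + fps_X) * z ^ 2)) * poly_at N z"
    unfolding N'_at T_at by (simp add: z del: of_nat_Suc)
  moreover have "(1 + fps_X) * z ^ 2 \<noteq> 0"
    using z by (auto simp: power2_eq_square)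
  moreover have "of_nat (Suc (2 * k)) \<noteq> (0 :: complex fps)"
    using fps_of_poly_eq_iff[of "of_nat (Suc (2 * k)) :: complex poly" 0]
    by (simp add: fps_of_poly_of_nat del: of_nat_Suc)
  ultimately have "poly_at N' z \<noteq> 0"
    using N(2) by (simp del: of_nat_Suc)
  moreover have "poly_at N' C = D ^ Suc (2 * Suc k) * fps_XD Y"
  proof -
    have XD_D: "D * fps_XD D = poly_at T C"
    proof -
      have "D * fps_XD D = D * (fps_X * (1 - C)) - (1 + fps_X) * (D * fps_XD C)"
        by (simp add: D_def fps_XD_def algebra_simps)
      thus ?thesis
        unfolding ode[folded D_def] T_at D_def[symmetric] by (simp add: algebra_simps)
    qed
    have "D * (D * poly_at (map_poly poly_XD N) C + poly_at (pderiv N) C * (fps_X * C ^ 2)) =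
        D * (D * fps_XD (poly_at N C))"
      unfolding fps_XD_poly_at ode[folded D_def, symmetric] by (simp add: algebra_simps)
    also have "\<dots> = of_nat (Suc (2 * k)) * (D * fps_XD D) * (D ^ Suc (2 * k) * Y)
        + D ^ Suc (2 * Suc k) * fps_XD Y"
      unfolding N(1) fps_XD_mult fps_XD_power_Suc by (simp add: algebra_simps)
    finally show ?thesis
      unfolding N'_at D_def[symmetric] XD_D N(1) by simp
  qed
  ultimately show ?case
    unfolding D_def Y_def by auto
qed

text \<open>
  After multiplication by \<open>D^(2 d - 1)\<close> every term of order less than \<open>d\<close>, and the right-hand side,
  retains a factor \<open>D\<close>. So at \<open>C = z\<close>, where \<open>D = 0\<close>, only the nonzero numerator of the term of order \<open>d\<close>
  is left. For \<open>d = 0\<close> the linear equation itself is the algebraic relation.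
\<close>

lemma dfinite_inverse_imp_algebraic:
  assumes ode: "(fps_X - (1 + fps_X) * C) * fps_XD C = fps_X * C ^ 2" and "dfinite C"
  shows "algebraic_fps C"
proof -
  define D where "D = fps_X - (1 + fps_X) * C"
  define z :: "complex fps" where "z = fps_X * inverse (1 + fps_X)"
  have "(1 + fps_X) * inverse (1 + fps_X) = (1 :: complex fps)"
    by (rule inverse_mult_eq_1') simp
  hence z: "(1 + fps_X) * z = fps_X"
    unfolding z_def by (simp add: mult.left_commute)
  obtain d q r where q: "q d \<noteq> 0"
    and eq: "(\<Sum>k\<le>d. fps_of_poly (q k) * (fps_XD ^^ k) C) = fps_of_poly r"
    using assms(2) unfolding dfinite_def by blast
  obtain N where N: "\<And>k. poly_at (N k) C = D ^ Suc (2 * k) * (fps_XD ^^ Suc k) C"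
    "\<And>k. poly_at (N k) z \<noteq> 0"
    using XD_powers_inverse[OF ode z] unfolding D_def by metis
  show ?thesis
  proof (cases d)
    case 0
    thus ?thesis
      unfolding algebraic_fps_def
      using q eq by (intro exI[of _ "[:- r, q 0:]"]) (auto simp: fps_of_poly_uminus mult.commute)
  next
    case (Suc e)
    define \<Delta> :: "complex poly poly" where "\<Delta> = [:[:0, 1:], - [:1, 1:]:]"
    have \<Delta>_at: "poly_at \<Delta> H = fps_X - (1 + fps_X) * H" for H
      unfolding \<Delta>_def poly_at_pCons fps_of_poly_uminus
      by (simp add: fps_of_poly_fps_X fps_of_poly_linear' algebra_simps)
    define P where "P = (\<Sum>k\<le>e. smult (q (Suc k)) (N k * \<Delta> ^ (2 * (e - k)))) +
      (smult (q 0) [:0, 1:] - [:r:]) * \<Delta> ^ Suc (2 * e)"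
    have P_at: "poly_at P H = (\<Sum>k\<le>e. fps_of_poly (q (Suc k)) * (poly_at (N k) H *
        (fps_X - (1 + fps_X) * H) ^ (2 * (e - k)))) +
        (fps_of_poly (q 0) * H - fps_of_poly r) * (fps_X - (1 + fps_X) * H) ^ Suc (2 * e)" for H
      unfolding P_def poly_at_add poly_at_mult poly_at_sum poly_at_smult poly_at_diff
        poly_at_power \<Delta>_at by simp
    have "poly_at P C = (\<Sum>k\<le>e. D ^ Suc (2 * e) * (fps_of_poly (q (Suc k)) * (fps_XD ^^ Suc k) C)) +
        (fps_of_poly (q 0) * C - fps_of_poly r) * D ^ Suc (2 * e)"
      unfolding P_at D_def[symmetric] N(1)
    proof (intro arg_cong2[where f = "(+)"] sum.cong refl)
      fix k assume "k \<in> {..e}"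
      hence "Suc (2 * e) = Suc (2 * k) + 2 * (e - k)" by auto
      hence "D ^ Suc (2 * e) = D ^ Suc (2 * k) * D ^ (2 * (e - k))"
        by (simp only: power_add)
      thus "fps_of_poly (q (Suc k)) * (D ^ Suc (2 * k) * (fps_XD ^^ Suc k) C * D ^ (2 * (e - k))) =
          D ^ Suc (2 * e) * (fps_of_poly (q (Suc k)) * (fps_XD ^^ Suc k) C)"
        by (simp only: mult_ac)
    qed
    also have "\<dots> = D ^ Suc (2 * e) * ((\<Sum>k\<le>d. fps_of_poly (q k) * (fps_XD ^^ k) C) - fps_of_poly r)"
      unfolding Suc sum.atMost_Suc_shift sum_distrib_left[symmetric] by (simp add: algebra_simps)
    finally have root: "poly_at P C = 0"
      by (simp add: eq)
    have "poly_at P z =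
        (\<Sum>k\<le>e. fps_of_poly (q (Suc k)) * (poly_at (N k) z * 0 ^ (2 * (e - k))))"
      unfolding P_at z by simp
    also have "\<dots> = (\<Sum>k\<in>{e}. fps_of_poly (q (Suc k)) * (poly_at (N k) z * 0 ^ (2 * (e - k))))"
      by (intro sum.mono_neutral_right) auto
    finally have "poly_at P z = fps_of_poly (q (Suc e)) * poly_at (N e) z"
      by simp
    hence "poly_at P z \<noteq> 0"
      using N(2)[of e] q fps_of_poly_eq_iff[of "q d" 0] by (simp add: Suc)
    with root show ?thesis
      unfolding algebraic_fps_def by (intro exI[of _ P]) auto
  qed
qed

text \<open>
  Composing \<open>P(x, C(x)) = 0\<close> with \<open>F\<close> gives \<open>P(F(x), x) = 0\<close>, a relation with the roles of the two
  variables exchanged; \<open>Q\<close> in the proof is the transposed polynomial.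
\<close>

lemma algebraic_compositional_inverse:
  assumes "algebraic_fps C" "C oo F = fps_X" "fps_nth F 0 = 0"
  shows "algebraic_fps F"
proof -
  obtain P where P: "P \<noteq> 0" "poly_at P C = 0"
    using assms(1) unfolding algebraic_fps_def by blast
  define m where "m = (\<Sum>j\<le>degree P. degree (coeff P j))"
  have deg: "degree (coeff P j) \<le> m" for j
  proof (cases "j \<le> degree P")
    case True
    thus ?thesis unfolding m_def by (intro member_le_sum) auto
  qed (simp add: coeff_eq_0)
  define Q where "Q = (\<Sum>i\<le>m. \<Sum>j\<le>degree P. monom (monom (coeff (coeff P j) i) j) i)"
  have compose_poly: "fps_of_poly p oo F = (\<Sum>i\<le>m. fps_const (coeff p i) * F ^ i)"
    if "degree p \<le> m" for p
  proof -
    have "fps_of_poly p = fps_of_poly (\<Sum>i\<le>m. monom (coeff p i) i)"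
      using that by (simp add: poly_as_sum_of_monoms')
    thus ?thesis
      using assms(3) by (simp add: fps_of_poly_sum fps_of_poly_monom fps_compose_sum_distrib
          fps_compose_mult_distrib fps_compose_power[symmetric])
  qed
  have monom_at: "poly_at (monom p i) F = fps_of_poly p * F ^ i" for p i
    by (induction i) (simp_all add: monom_0 monom_Suc mult_ac)
  have "0 = poly_at P C oo F"
    by (simp add: P)
  also have "\<dots> = (\<Sum>j\<le>degree P. (fps_of_poly (coeff P j) oo F) * fps_X ^ j)"
    using assms(2,3) by (simp add: poly_at_altdef[OF order.refl] fps_compose_sum_distrib
        fps_compose_mult_distrib fps_compose_power[symmetric])
  also have "\<dots> = (\<Sum>j\<le>degree P. \<Sum>i\<le>m. fps_const (coeff (coeff P j) i) * F ^ i * fps_X ^ j)"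
    by (simp add: compose_poly[OF deg] sum_distrib_right)
  also have "\<dots> = poly_at Q F"
    unfolding Q_def poly_at_sum monom_at fps_of_poly_monom
    by (subst sum.swap) (simp add: mult_ac)
  finally have "poly_at Q F = 0" by simp
  moreover have "Q \<noteq> 0"
  proof
    assume "Q = 0"
    let ?j = "degree P" let ?i = "degree (coeff P ?j)"
    have "coeff (coeff Q ?i) ?j =
        (\<Sum>i\<le>m. \<Sum>j\<le>?j. if i = ?i \<and> j = ?j then coeff (coeff P ?j) ?i else 0)"
      unfolding Q_def coeff_sum coeff_monom by (intro sum.cong refl) auto
    also have "\<dots> = (\<Sum>i\<le>m. if i = ?i then coeff (coeff P ?j) ?i else 0)"
      by (intro sum.cong refl) auto
    also have "\<dots> = coeff (coeff P ?j) ?i"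
      using deg[of ?j] by simp
    finally show False
      using \<open>Q = 0\<close> P(1) by simp
  qed
  ultimately show ?thesis
    unfolding algebraic_fps_def by blast
qed

lemma algebraic_one_plus:
  assumes "algebraic_fps F"
  shows "algebraic_fps (1 + F)"
proof -
  obtain P where P: "P \<noteq> 0" "poly_at P F = 0"
    using assms unfolding algebraic_fps_def by blast
  have "poly_at (pcompose P [:- 1, 1:]) (1 + F) = 0"
    using P(2) by (simp add: fps_of_poly_uminus)
  moreover have "pcompose P [:- 1, 1:] \<noteq> 0"
    using P(1) by (simp add: pcompose_eq_0_iff)
  ultimately show ?thesis
    unfolding algebraic_fps_def by blast
qed

section \<open>The reciprocal and the compositional inverse of the factorial series\<close>

theorem reciprocal_not_dfinite:
  assumes "G * (1 + fact_fps) = 1"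
  shows "\<not> dfinite G"
proof
  let ?E = "1 + fact_fps"
  assume "dfinite G"
  have "fps_XD G * ?E + G * fps_XD ?E = 0"
    using assms fps_XD_mult[of G ?E] by (simp add: fps_XD_1)
  hence "fps_X * (G * (fps_XD G * ?E)) = - (G * G * (fps_X * fps_XD ?E))"
    by (simp only: eq_neg_iff_add_eq_0) algebra
  hence "fps_X * fps_XD G * (G * ?E) = - (G * G * ((1 - fps_X) * ?E - 1))"
    unfolding fact_fps_ode by (simp only: mult_ac)
  also have "\<dots> = G * G - (1 - fps_X) * G * (G * ?E)"
    by (simp add: algebra_simps)
  finally have "fps_X * fps_XD G = G ^ 2 - (1 - fps_X) * G"
    by (simp add: assms power2_eq_square)
  hence "algebraic_fps ?E"
    using dfinite_reciprocal_imp_algebraic algebraic_reciprocal assms \<open>dfinite G\<close> by blast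
  thus False
    using fact_fps_transcendental by blast
qed

theorem compositional_inverse_not_dfinite: "\<not> dfinite (fps_inv fact_fps)"
proof
  let ?F = "fact_fps" and ?C = "fps_inv fact_fps"
  assume df: "dfinite ?C"
  have C0: "fps_nth ?C 0 = 0"
    by (simp add: fps_inv_def)
  have "fps_X * fps_XD ?F = (1 - fps_X) * ?F - fps_X"
    using fact_fps_ode by (simp add: fps_XD_1 algebra_simps)
  hence "(fps_X * fps_XD ?F) oo ?C = ((1 - fps_X) * ?F - fps_X) oo ?C"
    by simp
  hence "?C * (?C * (fps_deriv ?F oo ?C)) = (1 - ?C) * fps_X - ?C"
    using C0 by (simp add: fps_XD_def fps_compose_mult_distrib fps_compose_sub_distrib fact_fps_inv)
  also have "\<dots> = fps_X - (1 + fps_X) * ?C"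
    by (simp add: algebra_simps)
  finally have "(?C * (?C * (fps_deriv ?F oo ?C))) * fps_XD ?C = (fps_X - (1 + fps_X) * ?C) * fps_XD ?C"
    by simp
  moreover have "(fps_deriv ?F oo ?C) * fps_deriv ?C = 1"
    using fps_compose_deriv[OF C0, of ?F] by (simp add: fact_fps_inv)
  hence "(?C * (?C * (fps_deriv ?F oo ?C))) * fps_XD ?C = fps_X * ?C ^ 2"
    by (simp add: fps_XD_def power2_eq_square mult_ac)
  ultimately have "(fps_X - (1 + fps_X) * ?C) * fps_XD ?C = fps_X * ?C ^ 2"
    by (rule trans[OF sym])
  hence "algebraic_fps ?C"
    using df by (rule dfinite_inverse_imp_algebraic)
  moreover have "fps_nth ?F 0 = 0"
    by (simp add: fact_fps_def)
  ultimately have "algebraic_fps ?F"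
    by (rule algebraic_compositional_inverse[OF _ fact_fps_inv(1)])
  hence "algebraic_fps (1 + ?F)"
    by (rule algebraic_one_plus)
  thus False
    using fact_fps_transcendental by blast
qed

section \<open>Counting permutations with prescribed images\<close>

text \<open>
  Composition of permutations with disjoint supports is a bijection onto the permutations of the
  union that preserve the pieces. The constraints \<open>Q\<close> and \<open>R\<close> are carried along because each of them
  depends only on the values on one piece.
\<close>

lemma card_permutes_split:
  assumes disj: "A \<inter> B = {}"
    and Q: "\<And>\<pi> \<rho>. (\<And>x. x \<in> A \<Longrightarrow> \<pi> x = \<rho> x) \<Longrightarrow> Q \<pi> \<longleftrightarrow> Q \<rho>"
    and R: "\<And>\<pi> \<rho>. (\<And>x. x \<in> B \<Longrightarrow> \<pi> x = \<rho> x) \<Longrightarrow> R \<pi> \<longleftrightarrow> R \<rho>"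
  shows "card {\<pi>. \<pi> permutes A \<union> B \<and> \<pi> ` A = A \<and> Q \<pi> \<and> R \<pi>} =
    card {\<alpha>. \<alpha> permutes A \<and> Q \<alpha>} * card {\<beta>. \<beta> permutes B \<and> R \<beta>}"
proof -
  let ?res = "\<lambda>\<pi> S x. if x \<in> S then \<pi> x else x"
  have on_A: "(\<alpha> \<circ> \<beta>) x = \<alpha> x" if "\<alpha> permutes A" "\<beta> permutes B" "x \<in> A" for \<alpha> \<beta> x
  proof -
    have "x \<notin> B" using that disj by auto
    thus ?thesis using permutes_not_in[OF that(2)] by simp
  qed
  have on_B: "(\<alpha> \<circ> \<beta>) x = \<beta> x" if "\<alpha> permutes A" "\<beta> permutes B" "x \<in> B" for \<alpha> \<beta> x
  proof -
    have "\<beta> x \<notin> A" using that disj by (auto simp: permutes_in_image[OF that(2)])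
    thus ?thesis using permutes_not_in[OF that(1)] by simp
  qed
  have res: "?res \<pi> A permutes A" "?res \<pi> B permutes B"
    if \<pi>: "\<pi> permutes A \<union> B" "\<pi> ` A = A" for \<pi>
  proof -
    have inj: "inj_on \<pi> S" for S
      using permutes_inj[OF \<pi>(1)] by (rule inj_on_subset) simp
    have "\<pi> ` (A \<union> B) = A \<union> B"
      using \<pi>(1) by (rule permutes_image)
    moreover have "\<pi> ` A \<inter> \<pi> ` B = {}"
      using image_Int[OF permutes_inj[OF \<pi>(1)], of A B] disj by simp
    ultimately have "\<pi> ` B = B"
      using \<pi>(2) disj by (auto simp: image_Un)
    thus "?res \<pi> A permutes A" "?res \<pi> B permutes B"
      using \<pi>(2) inj by (auto intro!: bij_imp_permutes simp: bij_betw_def inj_on_def)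
  qed
  have "bij_betw (\<lambda>(\<alpha>, \<beta>). \<alpha> \<circ> \<beta>)
      ({\<alpha>. \<alpha> permutes A \<and> Q \<alpha>} \<times> {\<beta>. \<beta> permutes B \<and> R \<beta>})
      {\<pi>. \<pi> permutes A \<union> B \<and> \<pi> ` A = A \<and> Q \<pi> \<and> R \<pi>}"
  proof (rule bij_betwI[where g = "\<lambda>\<pi>. (?res \<pi> A, ?res \<pi> B)"], goal_cases)
    case 1
    have "\<alpha> \<circ> \<beta> \<in> {\<pi>. \<pi> permutes A \<union> B \<and> \<pi> ` A = A \<and> Q \<pi> \<and> R \<pi>}"
      if \<alpha>\<beta>: "\<alpha> permutes A" "Q \<alpha>" "\<beta> permutes B" "R \<beta>" for \<alpha> \<beta>
    proof -
      have "\<alpha> \<circ> \<beta> permutes A \<union> B"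
        using \<alpha>\<beta>(1,3) by (intro permutes_compose) (auto intro: permutes_subset)
      moreover have "(\<alpha> \<circ> \<beta>) ` A = \<alpha> ` A"
        using on_A[OF \<alpha>\<beta>(1,3)] by (intro image_cong) auto
      moreover have "Q (\<alpha> \<circ> \<beta>)"
        by (rule Q[of "\<alpha> \<circ> \<beta>" \<alpha>, THEN iffD2]) (use on_A \<alpha>\<beta> in blast)+
      moreover have "R (\<alpha> \<circ> \<beta>)"
        by (rule R[of "\<alpha> \<circ> \<beta>" \<beta>, THEN iffD2]) (use on_B \<alpha>\<beta> in blast)+
      ultimately show ?thesis
        using permutes_image[OF \<alpha>\<beta>(1)] by simp
    qed
    note comp = this
    show ?case
    proof (rule Pi_I, elim SigmaE)
      fix p \<alpha> \<beta> assume "\<alpha> \<in> {\<alpha>. \<alpha> permutes A \<and> Q \<alpha>}" "\<beta> \<in> {\<beta>. \<beta> permutes B \<and> R \<beta>}" "p = (\<alpha>, \<beta>)"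
      thus "(case p of (\<alpha>, \<beta>) \<Rightarrow> \<alpha> \<circ> \<beta>) \<in> {\<pi>. \<pi> permutes A \<union> B \<and> \<pi> ` A = A \<and> Q \<pi> \<and> R \<pi>}"
        using comp[of \<alpha> \<beta>] by (simp only: prod.case mem_Collect_eq)
    qed
  next
    case 2
    have "Q (?res \<pi> A) = Q \<pi>" "R (?res \<pi> B) = R \<pi>" for \<pi>
      by (rule Q R; simp)+
    thus ?case using res by blast
  next
    case (3 p)
    then obtain \<alpha> \<beta> where p: "p = (\<alpha>, \<beta>)" "\<alpha> permutes A" "\<beta> permutes B"
      by auto
    have "?res (\<alpha> \<circ> \<beta>) A = \<alpha>" "?res (\<alpha> \<circ> \<beta>) B = \<beta>"
      using on_A[OF p(2,3)] on_B[OF p(2,3)] permutes_not_in[OF p(2)] permutes_not_in[OF p(3)]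
      by (auto simp del: o_apply)
    thus ?case by (simp only: p(1) prod.case)
  next
    case (4 \<pi>)
    hence \<pi>: "\<pi> permutes A \<union> B" "\<pi> ` A = A" by auto
    have "(?res \<pi> A \<circ> ?res \<pi> B) x = \<pi> x" for x
      using on_A[OF res[OF \<pi>], of x] on_B[OF res[OF \<pi>], of x]
        permutes_not_in[OF \<pi>(1), of x] by (cases "x \<in> A"; cases "x \<in> B") auto
    thus ?case by (auto simp: fun_eq_iff)
  qed
  thus ?thesis
    by (simp add: bij_betw_same_card[symmetric] card_cartesian_product)
qed

lemma card_permutes_preserving:
  assumes "finite I" "disjoint_family_on P I" "\<And>i. i \<in> I \<Longrightarrow> finite (P i)"
  shows "card {\<pi>. \<pi> permutes (\<Union>i\<in>I. P i) \<and> (\<forall>i\<in>I. \<pi> ` P i = P i)} =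
    (\<Prod>i\<in>I. fact (card (P i)))"
  using assms
proof (induction I)
  case empty
  have "{\<pi>. \<pi> permutes ({} :: 'b set)} = {id}" by (auto simp: permutes_empty)
  thus ?case by simp
next
  case (insert a I)
  let ?B = "\<Union>i\<in>I. P i"
  have disj: "P a \<inter> ?B = {}"
  proof -
    have "P a \<inter> P i = {}" if "i \<in> I" for i
      using insert.hyps(2) that by (intro disjoint_family_onD[OF insert.prems(1)]) auto
    thus ?thesis by blast
  qed
  have local: "(\<forall>i\<in>I. \<pi> ` P i = P i) \<longleftrightarrow> (\<forall>i\<in>I. \<rho> ` P i = P i)"
    if eq: "\<And>x. x \<in> ?B \<Longrightarrow> \<pi> x = \<rho> x" for \<pi> \<rho>
  proof -
    have "\<pi> ` P i = \<rho> ` P i" if "i \<in> I" for i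
      by (rule image_cong[OF refl eq]) (use that in blast)
    thus ?thesis by simp
  qed
  have "card {\<pi>. \<pi> permutes P a \<union> ?B \<and> \<pi> ` P a = P a \<and> True \<and>
      (\<forall>i\<in>I. \<pi> ` P i = P i)} =
      card {\<alpha>. \<alpha> permutes P a \<and> True} * card {\<beta>. \<beta> permutes ?B \<and> (\<forall>i\<in>I. \<beta> ` P i = P i)}"
    by (rule card_permutes_split[OF disj refl local])
  moreover have "disjoint_family_on P I"
    using insert.prems(1) by (rule disjoint_family_on_mono[rotated]) auto
  hence "card {\<beta>. \<beta> permutes ?B \<and> (\<forall>i\<in>I. \<beta> ` P i = P i)} = (\<Prod>i\<in>I. fact (card (P i)))"
    using insert.IH insert.prems(2) by simp
  moreover have "card {\<alpha>. \<alpha> permutes P a} = fact (card (P a))"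
    using insert.prems(2) by (intro card_permutations) auto
  ultimately show ?case
    using insert.hyps by simp
qed

text \<open>
  Composing with the inverse of one permutation \<open>g\<close> that sends each \<open>P i\<close> to \<open>V i\<close> reduces this to
  permutations that preserve every \<open>P i\<close>.
\<close>

lemma card_permutes_with_images:
  assumes I: "finite I" and P: "disjoint_family_on P I" "\<And>i. i \<in> I \<Longrightarrow> finite (P i)"
    and V: "disjoint_family_on V I" "\<And>i. i \<in> I \<Longrightarrow> card (V i) = card (P i)"
      "\<And>i. i \<in> I \<Longrightarrow> finite (V i)"
    and A: "(\<Union>i\<in>I. P i) = A" "(\<Union>i\<in>I. V i) = A"
  shows "card {\<pi>. \<pi> permutes A \<and> (\<forall>i\<in>I. \<pi> ` P i = V i)} = (\<Prod>i\<in>I. fact (card (P i)))"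
proof -
  have "\<exists>f. \<forall>i\<in>I. bij_betw f (P i) (V i)"
    using I P V(2,3)
  proof (induction I)
    case (insert a I)
    have "disjoint_family_on P I"
      using insert.prems(1) by (rule disjoint_family_on_mono[rotated]) auto
    hence "\<exists>f. \<forall>i\<in>I. bij_betw f (P i) (V i)"
      using insert.IH insert.prems(2-4) by simp
    then obtain f where f: "\<And>i. i \<in> I \<Longrightarrow> bij_betw f (P i) (V i)"
      by blast
    obtain h where h: "bij_betw h (P a) (V a)"
      using insert.prems finite_same_card_bij[of "P a" "V a"] by auto
    have "bij_betw (\<lambda>x. if x \<in> P a then h x else f x) (P i) (V i)" if "i \<in> insert a I" for i
    proof (cases "i = a")
      case True
      have "bij_betw (\<lambda>x. if x \<in> P a then h x else f x) (P a) (V a) = bij_betw h (P a) (V a)"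
        by (intro bij_betw_cong) auto
      thus ?thesis using h True by simp
    next
      case False
      hence "P i \<inter> P a = {}"
        using insert.prems(1) that by (auto simp: disjoint_family_on_def)
      hence "bij_betw (\<lambda>x. if x \<in> P a then h x else f x) (P i) (V i) = bij_betw f (P i) (V i)"
        by (intro bij_betw_cong) auto
      thus ?thesis using f False that by simp
    qed
    thus ?case by blast
  qed auto
  then obtain f where f: "\<And>i. i \<in> I \<Longrightarrow> bij_betw f (P i) (V i)" by blast
  have "f x = f y \<longrightarrow> x = y" if xy: "x \<in> A" "y \<in> A" for x y
  proof
    assume eq: "f x = f y"
    obtain i j where ij: "i \<in> I" "x \<in> P i" "j \<in> I" "y \<in> P j"
      using xy unfolding A(1)[symmetric] by blast
    hence "f x \<in> V i" "f y \<in> V j"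
      using f bij_betwE by metis+
    hence "i = j"
      using ij V(1) eq by (auto simp: disjoint_family_on_def)
    thus "x = y"
      using f[OF ij(1)] ij eq by (auto simp: bij_betw_def inj_on_def)
  qed
  hence "inj_on f A" by (auto simp: inj_on_def)
  moreover have "f ` A = (\<Union>i\<in>I. f ` P i)"
    using A(1) by auto
  hence "f ` A = A"
    using f A(2) by (simp add: bij_betw_def)
  ultimately have "bij_betw f A A" by (simp add: bij_betw_def)
  hence perm: "(\<lambda>x. if x \<in> A then f x else x) permutes A" (is "?g permutes A")
    by (intro bij_imp_permutes) (auto simp: bij_betw_def inj_on_def)
  have g: "?g ` P i = V i" if "i \<in> I" for i
  proof -
    have "?g ` P i = f ` P i"
      using that A(1) by (intro image_cong) auto
    thus ?thesis using f[OF that] by (simp add: bij_betw_def)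
  qed
  define g where "g = ?g"
  have g: "g permutes A" "\<And>i. i \<in> I \<Longrightarrow> g ` P i = V i"
    using perm g by (simp_all add: g_def)
  have g_inv: "inv g \<circ> g = id" "g \<circ> inv g = id"
    using permutes_inv_o[OF g(1)] by auto
  have V_inv: "inv g ` V i = P i" if "i \<in> I" for i
    by (simp only: g(2)[OF that, symmetric] image_comp g_inv image_id id_apply)
  have "bij_betw (\<lambda>\<pi>. inv g \<circ> \<pi>) {\<pi>. \<pi> permutes A \<and> (\<forall>i\<in>I. \<pi> ` P i = V i)}
      {\<pi>. \<pi> permutes A \<and> (\<forall>i\<in>I. \<pi> ` P i = P i)}"
  proof (rule bij_betwI[where g = "\<lambda>\<pi>. g \<circ> \<pi>"], goal_cases)
    case 1
    have "(inv g \<circ> \<pi>) ` P i = P i" if "i \<in> I" "\<pi> ` P i = V i" for \<pi> i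
      unfolding image_comp[symmetric] that(2) by (rule V_inv[OF that(1)])
    thus ?case
      by (intro Pi_I) (simp add: permutes_compose permutes_inv g(1) del: image_comp)
  next
    case 2
    have "(g \<circ> \<pi>) ` P i = V i" if "i \<in> I" "\<pi> ` P i = P i" for \<pi> i
      unfolding image_comp[symmetric] that(2) by (rule g(2)[OF that(1)])
    thus ?case
      by (intro Pi_I) (simp add: permutes_compose g(1) del: image_comp)
  qed (simp_all add: comp_assoc[symmetric] g_inv)
  hence "card {\<pi>. \<pi> permutes A \<and> (\<forall>i\<in>I. \<pi> ` P i = V i)} =
      card {\<pi>. \<pi> permutes A \<and> (\<forall>i\<in>I. \<pi> ` P i = P i)}"
    by (rule bij_betw_same_card)
  also have "\<dots> = (\<Prod>i\<in>I. fact (card (P i)))"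
    unfolding A(1)[symmetric] using I P by (rule card_permutes_preserving)
  finally show ?thesis .
qed

section \<open>Plus indecomposable permutations\<close>

text \<open>
  Sort the permutations \<open>\<pi>\<close> by the least \<open>j \<ge> 1\<close> with \<open>\<pi>({1..j}) = {1..j}\<close>: the restriction to \<open>{1..j}\<close> is
  plus indecomposable, and the restriction to the remaining points is arbitrary.
\<close>

lemma sum_num_plus_indecomposable:
  assumes "1 \<le> n"
  shows "(\<Sum>j=1..n. num_plus_indecomposable j * fact (n - j)) = fact n"
proof -
  define S where "S j = {\<pi>. \<pi> permutes {1..n} \<and> \<pi> ` {1..j} = {1..j} \<and>
      (\<forall>l. 1 \<le> l \<and> l < j \<longrightarrow> \<pi> ` {1..l} \<noteq> {1..l})}" for j
  have card_S: "card (S j) = num_plus_indecomposable j * fact (n - j)" if j: "j \<in> {1..n}" for j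
  proof -
    have split: "{1..n} = {1..j} \<union> {j<..n}" using j by auto
    have "card {\<pi>. \<pi> permutes {1..j} \<union> {j<..n} \<and> \<pi> ` {1..j} = {1..j} \<and>
        (\<forall>l. 1 \<le> l \<and> l < j \<longrightarrow> \<pi> ` {1..l} \<noteq> {1..l}) \<and> True} =
        card {\<alpha>. \<alpha> permutes {1..j} \<and> (\<forall>l. 1 \<le> l \<and> l < j \<longrightarrow> \<alpha> ` {1..l} \<noteq> {1..l})} *
        card {\<beta>. \<beta> permutes {j<..n} \<and> True}"
    proof (rule card_permutes_split, goal_cases)
      case (2 \<pi> \<rho>)
      have "\<pi> ` {1..l} = \<rho> ` {1..l}" if "l < j" for l
        using that by (intro image_cong) (auto intro!: 2)
      thus ?case by auto
    qed auto
    moreover have "{\<alpha>. \<alpha> permutes {1..j} \<and> (\<forall>l. 1 \<le> l \<and> l < j \<longrightarrow> \<alpha> ` {1..l} \<noteq> {1..l})} =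
        {\<alpha>. plus_indecomposable j \<alpha>}"
      by (auto simp: plus_indecomposable_def)
    ultimately show ?thesis
      unfolding split[symmetric]
      by (simp add: S_def num_plus_indecomposable_def card_permutations[OF refl])
  qed
  have "{\<pi>. \<pi> permutes {1..n}} = (\<Union>j\<in>{1..n}. S j)"
  proof (intro equalityI subsetI)
    fix \<pi> assume "\<pi> \<in> {\<pi>. \<pi> permutes {1..n}}"
    hence \<pi>: "\<pi> permutes {1..n}" by simp
    define j where "j = (LEAST j. 1 \<le> j \<and> \<pi> ` {1..j} = {1..j})"
    have n: "1 \<le> n \<and> \<pi> ` {1..n} = {1..n}"
      using assms permutes_image[OF \<pi>] by simp
    have "1 \<le> j \<and> \<pi> ` {1..j} = {1..j}"
      unfolding j_def using n by (rule LeastI)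
    moreover have "j \<le> n"
      unfolding j_def using n by (rule Least_le)
    moreover have "\<pi> ` {1..l} \<noteq> {1..l}" if "1 \<le> l" "l < j" for l
      using not_less_Least[of l "\<lambda>j. 1 \<le> j \<and> \<pi> ` {1..j} = {1..j}"] that by (auto simp: j_def)
    ultimately have "\<pi> \<in> S j" "j \<in> {1..n}"
      using \<pi> by (simp_all add: S_def)
    thus "\<pi> \<in> (\<Union>j\<in>{1..n}. S j)" by blast
  qed (auto simp: S_def)
  moreover have "card (\<Union>j\<in>{1..n}. S j) = (\<Sum>j=1..n. card (S j))"
  proof (rule card_UN_disjoint)
    show "\<forall>j\<in>{1..n}. finite (S j)"
      by (auto simp: S_def intro: finite_subset[OF _ finite_permutations[of "{1..n}"]])
    have "S i \<inter> S j = {}" if "i \<in> {1..n}" "i < j" for i j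
      using that by (auto simp: S_def)
    thus "\<forall>i\<in>{1..n}. \<forall>j\<in>{1..n}. i \<noteq> j \<longrightarrow> S i \<inter> S j = {}"
      by (metis Int_commute linorder_neqE_nat)
  qed simp
  moreover have "card {\<pi>. \<pi> permutes {1..n}} = fact n"
    by (rule card_permutations) simp_all
  ultimately show ?thesis
    by (simp add: card_S)
qed

definition plus_decomposable :: "nat \<Rightarrow> (nat \<Rightarrow> nat) \<Rightarrow> bool" where
  "plus_decomposable n \<pi> \<longleftrightarrow> (\<exists>j. 1 \<le> j \<and> j < n \<and> \<pi> ` {1..j} = {1..j})"

definition minus_decomposable :: "nat \<Rightarrow> (nat \<Rightarrow> nat) \<Rightarrow> bool" where
  "minus_decomposable n \<pi> \<longleftrightarrow> (\<exists>j. 1 \<le> j \<and> j < n \<and> \<pi> ` {1..j} = {n - j<..n})"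

text \<open>
  No permutation is both plus and minus decomposable, and reversing the values exchanges the two
  notions; hence each of them excludes \<open>n! - i_n\<close> of the \<open>n!\<close> permutations.
\<close>

lemma card_doubly_indecomposable:
  "card {\<pi>. \<pi> permutes {1..n} \<and> \<not> plus_decomposable n \<pi> \<and> \<not> minus_decomposable n \<pi>} + fact n =
    2 * num_plus_indecomposable n"
proof -
  define All where "All = {\<pi>. \<pi> permutes {1..n}}"
  define PI where "PI = {\<pi>\<in>All. \<not> plus_decomposable n \<pi>}"
  define MI where "MI = {\<pi>\<in>All. \<not> minus_decomposable n \<pi>}"
  define \<rho> where "\<rho> x = (if x \<in> {1..n} then n + 1 - x else x)" for x
  have \<rho>_image: "\<rho> ` {1..j} = {n - j<..n}" if "j \<le> n" for j
  proof (intro equalityI subsetI)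
    fix y assume "y \<in> {n - j<..n}"
    thus "y \<in> \<rho> ` {1..j}"
      using that by (intro image_eqI[of _ _ "n + 1 - y"]) (auto simp: \<rho>_def)
  qed (use that in \<open>auto simp: \<rho>_def\<close>)
  have \<rho>_inv: "\<rho> \<circ> \<rho> = id"
    by (auto simp: \<rho>_def fun_eq_iff)
  have "\<rho> ` {1..n} = {1..n}"
    using \<rho>_image[of n] by auto
  hence \<rho>: "\<rho> permutes {1..n}"
    by (intro bij_imp_permutes) (auto simp: bij_betw_def inj_on_def \<rho>_def)
  have \<rho>_image2: "\<rho> ` (\<rho> ` B) = B" for B
    by (simp add: image_comp \<rho>_inv)
  have image_iff: "(\<rho> \<circ> \<pi>) ` {1..j} = {1..j} \<longleftrightarrow> \<pi> ` {1..j} = {n - j<..n}" if "j < n" for j \<pi>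
  proof -
    have "(\<rho> \<circ> \<pi>) ` {1..j} = \<rho> ` (\<pi> ` {1..j})"
      by (simp add: image_comp)
    moreover have "\<rho> ` {1..j} = {n - j<..n}"
      using \<rho>_image[of j] that by simp
    ultimately show ?thesis
      using \<rho>_image2[of "\<pi> ` {1..j}"] \<rho>_image2[of "{1..j}"] by metis
  qed
  have plus_minus: "plus_decomposable n (\<rho> \<circ> \<pi>) \<longleftrightarrow> minus_decomposable n \<pi>" for \<pi>
    unfolding plus_decomposable_def minus_decomposable_def
    by (intro ex_cong1 conj_cong refl image_iff)
  have \<rho>_All: "\<rho> \<circ> \<pi> \<in> All" if "\<pi> \<in> All" for \<pi>
    using that permutes_compose[OF _ \<rho>] unfolding All_def by blast
  have "bij_betw (\<lambda>\<pi>. \<rho> \<circ> \<pi>) MI PI"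
  proof (rule bij_betwI[where g = "\<lambda>\<pi>. \<rho> \<circ> \<pi>"], goal_cases)
    case 1
    show ?case
      by (intro Pi_I) (simp add: MI_def PI_def \<rho>_All plus_minus)
  next
    case 2
    have "minus_decomposable n (\<rho> \<circ> \<pi>) \<longleftrightarrow> plus_decomposable n \<pi>" for \<pi>
      using plus_minus[of "\<rho> \<circ> \<pi>"] by (simp add: comp_assoc[symmetric] \<rho>_inv)
    thus ?case
      by (intro Pi_I) (simp add: MI_def PI_def \<rho>_All)
  qed (simp_all add: comp_assoc[symmetric] \<rho>_inv)
  hence MI: "card MI = card PI"
    by (rule bij_betw_same_card)
  have PI: "card PI = num_plus_indecomposable n"
    by (simp add: PI_def All_def num_plus_indecomposable_def plus_indecomposable_def
        plus_decomposable_def)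
  have fin: "finite All"
    by (simp add: All_def finite_permutations)
  have False if dec: "plus_decomposable n \<pi>" "minus_decomposable n \<pi>" for \<pi>
  proof -
    obtain j l where jl: "1 \<le> j" "j < n" "\<pi> ` {1..j} = {1..j}"
      "1 \<le> l" "l < n" "\<pi> ` {1..l} = {n - l<..n}"
      using dec unfolding plus_decomposable_def minus_decomposable_def by blast
    show False
    proof (cases "j \<le> l")
      case True
      hence "\<pi> ` {1..j} \<subseteq> \<pi> ` {1..l}" by (intro image_mono) auto
      hence "1 \<in> {n - l<..n}" using jl by auto
      thus False using jl by auto
    next
      case False
      hence "\<pi> ` {1..l} \<subseteq> \<pi> ` {1..j}" by (intro image_mono) auto
      hence "{n - l<..n} \<subseteq> {1..j}" unfolding jl(3,6) .
      moreover have "n \<in> {n - l<..n}" using jl by auto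
      ultimately have "n \<in> {1..j}" by blast
      thus False using jl by auto
    qed
  qed
  hence "PI \<union> MI = All"
    by (auto simp: PI_def MI_def)
  moreover have "card PI + card MI = card (PI \<union> MI) + card (PI \<inter> MI)"
    using fin by (intro card_Un_Int) (auto simp: PI_def MI_def)
  moreover have "PI \<inter> MI =
      {\<pi>. \<pi> permutes {1..n} \<and> \<not> plus_decomposable n \<pi> \<and> \<not> minus_decomposable n \<pi>}"
    by (auto simp: PI_def MI_def All_def)
  moreover have "card All = fact n"
    unfolding All_def by (rule card_permutations) simp_all
  ultimately show ?thesis
    using MI PI by simp
qed

section \<open>Compositions of an integer as interval partitions\<close>

definition cut_point :: "nat list \<Rightarrow> nat \<Rightarrow> nat" where
  "cut_point ns i = sum_list (take i ns)"

text \<open>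
  Parts are numbered from 1, so that they can be matched with the points of a permutation of
  \<open>{1..length ns}\<close>; part \<open>i\<close> therefore has length \<open>ns ! (i - 1)\<close>.
\<close>

definition part :: "nat list \<Rightarrow> nat \<Rightarrow> nat set" where
  "part ns i = {cut_point ns (i - 1)<..cut_point ns i}"

lemma cut_point_0 [simp]: "cut_point ns 0 = 0"
  by (simp add: cut_point_def)

lemma cut_point_length: "cut_point ns (length ns) = sum_list ns"
  by (simp add: cut_point_def)

lemma cut_point_Suc: "i < length ns \<Longrightarrow> cut_point ns (Suc i) = cut_point ns i + ns ! i"
  by (simp add: cut_point_def take_Suc_conv_app_nth)

lemma cut_point_mono: "i \<le> j \<Longrightarrow> cut_point ns i \<le> cut_point ns j"
  unfolding cut_point_def by (metis le_add1 le_Suc_ex sum_list_append take_add)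

lemma cut_point_le: "cut_point ns i \<le> sum_list ns"
  unfolding cut_point_def by (metis append_take_drop_id le_add1 sum_list_append)

lemma cut_point_strict_mono:
  assumes "0 \<notin> set ns" "i < j" "j \<le> length ns"
  shows "cut_point ns i < cut_point ns j"
proof -
  have "cut_point ns i < cut_point ns (Suc i)"
    using assms by (auto simp: cut_point_Suc) (metis gr_zeroI nth_mem order_less_le_trans)
  also have "\<dots> \<le> cut_point ns j"
    using assms(2) by (intro cut_point_mono) simp
  finally show ?thesis .
qed

lemma finite_part [simp]: "finite (part ns i)"
  by (simp add: part_def)

lemma card_part:
  assumes "i \<in> {1..length ns}"
  shows "card (part ns i) = ns ! (i - 1)"
  using assms cut_point_Suc[of "i - 1" ns] by (auto simp: part_def)

lemma part_nonempty:
  assumes "0 \<notin> set ns" "i \<in> {1..length ns}"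
  shows "part ns i \<noteq> {}"
  using cut_point_strict_mono[OF assms(1), of "i - 1" i] assms(2) by (simp add: part_def)

lemma part_less:
  assumes "i < j" "p \<in> part ns i" "q \<in> part ns j"
  shows "p < q"
proof -
  have "cut_point ns i \<le> cut_point ns (j - 1)"
    using assms(1) by (intro cut_point_mono) simp
  thus ?thesis using assms(2,3) by (simp add: part_def)
qed

lemma part_unique:
  assumes "p \<in> part ns i" "p \<in> part ns j"
  shows "i = j"
  using part_less[of i j p ns p] part_less[of j i p ns p] assms by (meson less_irrefl linorder_neqE_nat)

lemma part_inj:
  assumes "0 \<notin> set ns" "i \<in> {1..length ns}" "part ns i = part ns j"
  shows "i = j"
  using part_nonempty[OF assms(1,2)] assms(3) part_unique by blast

lemma disjoint_parts: "disjoint_family_on (part ns) I"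
  unfolding disjoint_family_on_def using part_unique by blast

lemma Union_parts_upto: "(\<Union>i\<in>{Suc a..b}. part ns i) = {cut_point ns a<..cut_point ns b}" if "a \<le> b"
  using that
proof (induction b rule: dec_induct)
  case (step b)
  have "{Suc a..Suc b} = insert (Suc b) {Suc a..b}"
    using step.hyps by auto
  hence "(\<Union>i\<in>{Suc a..Suc b}. part ns i) = part ns (Suc b) \<union> {cut_point ns a<..cut_point ns b}"
    by (simp add: step.IH)
  also have "\<dots> = {cut_point ns a<..cut_point ns (Suc b)}"
    using cut_point_mono[of a b ns] cut_point_mono[of b "Suc b" ns] step.hyps by (auto simp: part_def)
  finally show ?case .
qed simp

lemma Union_parts: "(\<Union>i\<in>{1..length ns}. part ns i) = {1..sum_list ns}"
  using Union_parts_upto[of 0 "length ns" ns]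
  by (simp add: cut_point_length atLeastSucAtMost_greaterThanAtMost)

lemma in_part_imp_le: "p \<in> part ns i \<Longrightarrow> p \<in> {1..sum_list ns}"
  using cut_point_le[of ns i] by (auto simp: part_def)

lemma obtain_part:
  assumes "p \<in> {1..sum_list ns}"
  obtains i where "i \<in> {1..length ns}" "p \<in> part ns i"
  using assms unfolding Union_parts[symmetric] by blast

lemma Union_parts_interval:
  assumes "T = {a..b}" "T \<noteq> {}" "T \<subseteq> {1..length ns}"
  shows "(\<Union>i\<in>T. part ns i) = {Suc (cut_point ns (a - 1))..cut_point ns b}"
proof -
  have "Suc (a - 1) = a" "a - 1 \<le> b"
    using assms by auto
  thus ?thesis
    using Union_parts_upto[of "a - 1" b ns] assms(1)
    by (simp add: atLeastSucAtMost_greaterThanAtMost)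
qed

lemma parts_meeting_interval:
  assumes ns: "0 \<notin> set ns" and B: "B = {x..y}" "B \<noteq> {}" "B \<subseteq> {1..sum_list ns}"
  shows "\<exists>a b. {i \<in> {1..length ns}. part ns i \<inter> B \<noteq> {}} = {a..b}"
proof -
  have xy: "x \<in> {1..sum_list ns}" "y \<in> {1..sum_list ns}" "x \<le> y"
    using B by auto
  obtain a b where a: "a \<in> {1..length ns}" "x \<in> part ns a"
    and b: "b \<in> {1..length ns}" "y \<in> part ns b"
    using obtain_part xy by metis
  have "part ns i \<inter> B \<noteq> {} \<longleftrightarrow> i \<in> {a..b}" if i: "i \<in> {1..length ns}" for i
  proof
    assume "part ns i \<inter> B \<noteq> {}"
    then obtain p where p: "p \<in> part ns i" "x \<le> p" "p \<le> y"
      using B(1) by auto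
    show "i \<in> {a..b}"
      using part_less[OF _ p(1) a(2)] part_less[OF _ b(2) p(1)] p(2,3) by fastforce
  next
    assume ab: "i \<in> {a..b}"
    obtain p where p: "p \<in> part ns i"
      using part_nonempty[OF ns i] by blast
    consider "i = a" | "i = b" | "a < i" "i < b"
      using ab by fastforce
    thus "part ns i \<inter> B \<noteq> {}"
    proof cases
      case 3
      hence "x < p" "p < y"
        using part_less[OF _ a(2) p] part_less[OF _ p b(2)] by auto
      thus ?thesis using p B(1) by auto
    qed (use a b B(1) xy(3) in auto)
  qed
  moreover have "{a..b} \<subseteq> {1..length ns}"
    using a(1) b(1) by auto
  ultimately have "{i \<in> {1..length ns}. part ns i \<inter> B \<noteq> {}} = {a..b}"
    by blast
  thus ?thesis by blast
qed

text \<open>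
  The maxima of the parts are the cut points, listed in increasing order, and the differences of
  consecutive cut points are the entries of the composition.
\<close>

lemma composition_determined_by_parts:
  assumes pos: "0 \<notin> set ns" "0 \<notin> set ms"
    and eq: "part ns ` {1..length ns} = part ms ` {1..length ms}"
  shows "ns = ms"
proof -
  have cuts: "Max ` (part xs ` {1..length xs}) = set (map (cut_point xs) [1..<Suc (length xs)])"
    if "0 \<notin> set xs" for xs
  proof -
    have "Max (part xs i) = cut_point xs i" if "i \<in> {1..length xs}" for i
      using cut_point_strict_mono[OF \<open>0 \<notin> set xs\<close>, of "i - 1" i] that
      unfolding part_def by (intro Max_eqI) auto
    thus ?thesis by (force simp: image_image)
  qed
  have sorted: "sorted (map (cut_point xs) [1..<Suc (length xs)])" for xs
    by (intro sorted_map_mono) (auto simp: mono_on_def cut_point_mono simp del: upt_Suc)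
  have distinct: "distinct (map (cut_point xs) [1..<Suc (length xs)])" if "0 \<notin> set xs" for xs
  proof -
    have "inj_on (cut_point xs) (set [1..<Suc (length xs)])"
    proof (rule linorder_inj_onI')
      fix i j assume "j \<in> set [1..<Suc (length xs)]" "i < j"
      thus "cut_point xs i \<noteq> cut_point xs j"
        using cut_point_strict_mono[OF that, of i j] by (auto simp del: upt_Suc)
    qed
    thus ?thesis by (simp add: distinct_map del: upt_Suc)
  qed
  have cut_eq: "map (cut_point ns) [1..<Suc (length ns)] = map (cut_point ms) [1..<Suc (length ms)]"
    using cuts[OF pos(1)] cuts[OF pos(2)] eq
    by (intro sorted_distinct_set_unique sorted distinct pos) simp
  hence len: "length ns = length ms"
    by (metis diff_Suc_1 length_map length_upt)
  have "cut_point ns i = cut_point ms i" if "i \<le> length ns" for i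
  proof (cases "i = 0")
    case False
    hence "map (cut_point ns) [1..<Suc (length ns)] ! (i - 1) = map (cut_point ms) [1..<Suc (length ms)] ! (i - 1)"
      by (simp only: cut_eq)
    thus ?thesis
      using that False len by (simp del: upt_Suc)
  qed simp
  hence "ns ! i = ms ! i" if "i < length ns" for i
    using cut_point_Suc[of i ns] cut_point_Suc[of i ms] that len by (metis Suc_leI add_left_cancel less_imp_le)
  thus ?thesis
    using len by (intro nth_equalityI) auto
qed

text \<open>
  By induction on \<open>n\<close>: the member that contains \<open>n\<close> is an interval \<open>{a..n}\<close>, and the others partition
  \<open>{1..a - 1}\<close>.
\<close>

lemma interval_partition_is_composition:
  assumes "\<Union>\<P> = {1..n}" "disjoint \<P>" "\<And>X. X \<in> \<P> \<Longrightarrow> X \<noteq> {} \<and> (\<exists>a b. X = {a..b})"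
  shows "\<exists>ns. 0 \<notin> set ns \<and> sum_list ns = n \<and> \<P> = part ns ` {1..length ns}"
  using assms
proof (induction n arbitrary: \<P> rule: less_induct)
  case (less n)
  show ?case
  proof (cases "n = 0")
    case True
    hence "\<P> = {}" using less.prems(1,3) by fastforce
    thus ?thesis using True by (intro exI[of _ "[]"]) simp
  next
    case False
    then obtain X where X: "X \<in> \<P>" "n \<in> X"
      using less.prems(1) by (metis UnionE atLeastAtMost_iff less_one not_le order.refl)
    obtain a b where ab: "X = {a..b}"
      using less.prems(3)[OF X(1)] by blast
    have sub: "X \<subseteq> {1..n}"
      using X(1) less.prems(1) by blast
    have "a \<in> X" "b \<in> X"
      using X(2) by (auto simp: ab)
    hence bn: "b = n" and a: "1 \<le> a" "a \<le> n"
      using subsetD[OF sub, of a] subsetD[OF sub, of b] X(2) by (auto simp: ab)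
    have "\<Union>(\<P> - {X}) = {1..a - 1}"
    proof -
      have "\<Union>(\<P> - {X}) = \<Union>\<P> - X"
        using less.prems(2) X(1) unfolding disjoint_def by fastforce
      thus ?thesis
        using a by (auto simp: less.prems(1) ab bn)
    qed
    moreover have "disjoint (\<P> - {X})"
      using less.prems(2) by (auto simp: disjoint_def)
    moreover have "a - 1 < n"
      using a by simp
    ultimately have "\<exists>ns. 0 \<notin> set ns \<and> sum_list ns = a - 1 \<and> \<P> - {X} = part ns ` {1..length ns}"
      by (intro less.IH) (use less.prems(3) in blast)+
    then obtain ns where ns: "0 \<notin> set ns" "sum_list ns = a - 1"
      "\<P> - {X} = part ns ` {1..length ns}"
      by blast
    define ms where "ms = ns @ [n - (a - 1)]"
    have "part ms i = part ns i" if "i \<in> {1..length ns}" for i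
      using that by (simp add: ms_def part_def cut_point_def)
    moreover have "part ms (Suc (length ns)) = X"
      using a ns(2) by (auto simp: ms_def part_def cut_point_def ab bn)
    moreover have "{1..length ms} = insert (Suc (length ns)) {1..length ns}"
      by (auto simp: ms_def)
    ultimately have "part ms ` {1..length ms} = insert X (\<P> - {X})"
      by (simp add: ns(3))
    moreover have "0 \<notin> set ms" "sum_list ms = n"
      using ns a by (auto simp: ms_def)
    ultimately show ?thesis
      using X(1) by (metis insert_Diff)
  qed
qed

section \<open>Inflations of simple permutations\<close>

text \<open>
  The permutation \<open>\<pi>\<close> arises from \<open>\<sigma>\<close> by replacing every point by a block. The compositions \<open>ns\<close> and
  \<open>ms\<close> list the lengths of these blocks in the order of their positions and of their values. The list
  \<open>ms\<close> is determined by \<open>ns\<close> and \<open>\<sigma>\<close>, but as a parameter it makes the description symmetric in positions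
  and values.
\<close>

locale inflation =
  fixes ns ms :: "nat list" and \<sigma> \<pi> :: "nat \<Rightarrow> nat"
  assumes pos: "0 \<notin> set ns" "0 \<notin> set ms"
    and len: "length ms = length ns"
    and sum: "sum_list ms = sum_list ns"
    and \<sigma>: "\<sigma> permutes {1..length ns}"
    and \<pi>: "\<pi> permutes {1..sum_list ns}"
    and parts: "\<And>i. i \<in> {1..length ns} \<Longrightarrow> \<pi> ` part ns i = part ms (\<sigma> i)"
begin

abbreviation "k \<equiv> length ns"
abbreviation "n \<equiv> sum_list ns"

lemma \<sigma>_in: "i \<in> {1..k} \<Longrightarrow> \<sigma> i \<in> {1..k}"
  using permutes_in_image[OF \<sigma>] by blast

lemma block_of_inflation:
  assumes "is_block k \<sigma> T"
  shows "is_block n \<pi> (\<Union>i\<in>T. part ns i)"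
proof -
  obtain a b c d where T: "T \<noteq> {}" "T \<subseteq> {1..k}" "T = {a..b}" "\<sigma> ` T = {c..d}"
    using assms unfolding is_block_def by blast
  have \<sigma>T: "\<sigma> ` T \<noteq> {}" "\<sigma> ` T \<subseteq> {1..length ms}"
    using T(1,2) \<sigma>_in len by auto
  have "\<pi> ` (\<Union>i\<in>T. part ns i) = (\<Union>i\<in>T. \<pi> ` part ns i)"
    by (rule image_UN)
  also have "\<dots> = (\<Union>i\<in>T. part ms (\<sigma> i))"
    by (intro SUP_cong refl parts) (use T(2) in blast)
  finally have "\<pi> ` (\<Union>i\<in>T. part ns i) = (\<Union>j\<in>\<sigma> ` T. part ms j)"
    by simp
  moreover have "(\<Union>i\<in>T. part ns i) \<noteq> {}"
    using T(1,2) part_nonempty[OF pos(1)] by blast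
  moreover have "(\<Union>i\<in>T. part ns i) \<subseteq> {1..n}"
    using in_part_imp_le by blast
  ultimately show ?thesis
    unfolding is_block_def
    using Union_parts_interval[OF T(3,1,2)] Union_parts_interval[OF T(4) \<sigma>T] by metis
qed

text \<open>
  An interval meets an interval of consecutive parts. This holds for \<open>B\<close> among the positions and for
  its image among the values, and \<open>\<sigma>\<close> maps the parts met by \<open>B\<close> to those met by the image.
\<close>

lemma parts_meeting_block:
  assumes "is_block n \<pi> B"
  shows "is_block k \<sigma> {i \<in> {1..k}. part ns i \<inter> B \<noteq> {}}" (is "is_block k \<sigma> ?T")
proof -
  obtain x y u v where B: "B \<noteq> {}" "B \<subseteq> {1..n}" "B = {x..y}" "\<pi> ` B = {u..v}"
    using assms unfolding is_block_def by blast
  have meet: "part ms (\<sigma> i) \<inter> \<pi> ` B \<noteq> {} \<longleftrightarrow> part ns i \<inter> B \<noteq> {}" if "i \<in> {1..k}" for i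
    unfolding parts[OF that, symmetric] image_Int[OF permutes_inj[OF \<pi>], symmetric] by simp
  have "\<sigma> ` ?T = {j \<in> {1..length ms}. part ms j \<inter> \<pi> ` B \<noteq> {}}"
  proof (intro equalityI subsetI)
    fix j assume j: "j \<in> {j \<in> {1..length ms}. part ms j \<inter> \<pi> ` B \<noteq> {}}"
    hence "j \<in> \<sigma> ` {1..k}"
      using permutes_image[OF \<sigma>] len by simp
    thus "j \<in> \<sigma> ` ?T"
      using j meet by blast
  qed (use meet \<sigma>_in len in auto)
  moreover have "\<pi> ` B \<noteq> {}" "\<pi> ` B \<subseteq> {1..sum_list ms}"
    using B(1,2) permutes_in_image[OF \<pi>] sum by auto
  hence "\<exists>c d. {j \<in> {1..length ms}. part ms j \<inter> \<pi> ` B \<noteq> {}} = {c..d}"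
    using parts_meeting_interval[OF pos(2) B(4)] by blast
  moreover have "\<exists>a b. ?T = {a..b}"
    by (rule parts_meeting_interval[OF pos(1) B(3,1,2)])
  moreover have "?T \<noteq> {}"
  proof -
    obtain p where p: "p \<in> B" using B(1) by blast
    then obtain i where "i \<in> {1..k}" "p \<in> part ns i"
      using obtain_part B(2) by blast
    thus ?thesis using p by blast
  qed
  ultimately show ?thesis
    unfolding is_block_def by auto
qed

context
  assumes simple: "simple_perm k \<sigma>" and k: "3 \<le> k"
begin

text \<open>
  If a block \<open>B\<close> meets all parts but does not contain the first one (or the last one), then its image
  meets all parts but does not contain that part's image, which must then be the lowest or the highest. So
  \<open>\<sigma>\<close> maps an extreme point to an extreme value, and the other points of \<open>\<sigma>\<close> form a proper block.
\<close>

lemma contains_extreme_part: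
  assumes B: "is_block n \<pi> B" and all: "\<And>i. i \<in> {1..k} \<Longrightarrow> part ns i \<inter> B \<noteq> {}"
    and e: "e = 1 \<or> e = k"
  shows "part ns e \<subseteq> B"
proof (rule ccontr)
  assume not_sub: "\<not> part ns e \<subseteq> B"
  obtain u v where "\<pi> ` B = {u..v}"
    using B unfolding is_block_def by blast
  have e_in: "e \<in> {1..k}" using e k by auto
  have "\<not> part ms (\<sigma> e) \<subseteq> \<pi> ` B"
    using not_sub unfolding parts[OF e_in, symmetric] inj_image_subset_iff[OF permutes_inj[OF \<pi>]] .
  then obtain q where q: "q \<in> part ms (\<sigma> e)" "q \<notin> \<pi> ` B" by blast
  have "\<sigma> e = 1 \<or> \<sigma> e = k"
  proof (rule ccontr)
    assume "\<not> (\<sigma> e = 1 \<or> \<sigma> e = k)"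
    hence "1 < \<sigma> e" "\<sigma> e < k"
      using \<sigma>_in[OF e_in] by auto
    have "part ms j \<inter> \<pi> ` B \<noteq> {}" if j: "j \<in> {1..k}" for j
    proof -
      obtain i where i: "i \<in> {1..k}" "j = \<sigma> i"
        using permutes_image[OF \<sigma>] j by blast
      show ?thesis
        using all[OF i(1)] unfolding i(2) parts[OF i(1), symmetric] by blast
    qed
    hence "part ms 1 \<inter> \<pi> ` B \<noteq> {}" "part ms k \<inter> \<pi> ` B \<noteq> {}"
      using k by simp_all
    then obtain r s where r: "r \<in> part ms 1" "r \<in> \<pi> ` B" and s: "s \<in> part ms k" "s \<in> \<pi> ` B"
      by blast
    have "r < q" "q < s"
      using part_less[OF \<open>1 < \<sigma> e\<close> r(1) q(1)] part_less[OF \<open>\<sigma> e < k\<close> q(1) s(1)] .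
    thus False
      using q(2) r(2) s(2) \<open>\<pi> ` B = {u..v}\<close> by auto
  qed
  have interval: "\<exists>c d. {1..k} - {f} = {c..d}" if "f = 1 \<or> f = k" for f
    using that
  proof
    assume "f = 1"
    hence "{1..k} - {f} = {2..k}" by auto
    thus ?thesis by blast
  next
    assume "f = k"
    hence "{1..k} - {f} = {1..k - 1}" by auto
    thus ?thesis by blast
  qed
  have image: "\<sigma> ` ({1..k} - {e}) = {1..k} - {\<sigma> e}"
    using permutes_image[OF \<sigma>] by (simp add: image_set_diff[OF permutes_inj[OF \<sigma>]])
  have card: "card ({1..k} - {e}) = k - 1"
    using e_in by simp
  hence "card ({1..k} - {e}) \<noteq> 0"
    using k by linarith
  hence "{1..k} - {e} \<noteq> {}"
    by (metis card.empty)
  hence "is_block k \<sigma> ({1..k} - {e})"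
    unfolding is_block_def image
    using interval[OF e] interval[OF \<open>\<sigma> e = 1 \<or> \<sigma> e = k\<close>] by blast
  hence "is_singleton ({1..k} - {e}) \<or> {1..k} - {e} = {1..k}"
    using simple unfolding simple_perm_def by blast
  moreover have "{1..k} - {e} \<noteq> {1..k}"
    using e_in by blast
  ultimately show False
    using k card by (simp add: is_singleton_altdef)
qed

text \<open>
  The parts met by \<open>B\<close> correspond to a block of the simple permutation \<open>\<sigma>\<close>. Either it is a singleton,
  or \<open>B\<close> meets all parts; in the latter case \<open>B\<close> contains the two extreme parts and all that lies between
  them.
\<close>

lemma block_in_part_or_full:
  assumes B: "is_block n \<pi> B" and "B \<noteq> {1..n}"
  shows "\<exists>i\<in>{1..k}. B \<subseteq> part ns i"
proof -
  let ?T = "{i \<in> {1..k}. part ns i \<inter> B \<noteq> {}}"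
  obtain x y where xy: "B = {x..y}" "B \<subseteq> {1..n}"
    using B unfolding is_block_def by blast
  have "?T \<noteq> {1..k}"
  proof
    assume "?T = {1..k}"
    hence all: "part ns i \<inter> B \<noteq> {}" if "i \<in> {1..k}" for i
      using that by blast
    have "part ns 1 \<subseteq> B" "part ns k \<subseteq> B"
      using contains_extreme_part[OF B all] by auto
    moreover have "part ns 1 \<noteq> {}" "part ns k \<noteq> {}"
      using k by (auto intro!: part_nonempty[OF pos(1)])
    ultimately obtain r s where r: "r \<in> part ns 1" "r \<in> B" and s: "s \<in> part ns k" "s \<in> B"
      by blast
    have "p \<in> B" if p: "p \<in> {1..n}" for p
    proof -
      obtain i where i: "i \<in> {1..k}" "p \<in> part ns i"
        using p by (rule obtain_part)
      consider "i = 1" | "i = k" | "1 < i" "i < k"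
        using i(1) by fastforce
      thus ?thesis
      proof cases
        case 3
        thus ?thesis
          using part_less[OF _ r(1) i(2)] part_less[OF _ i(2) s(1)] r(2) s(2) xy(1) by fastforce
      qed (use i \<open>part ns 1 \<subseteq> B\<close> \<open>part ns k \<subseteq> B\<close> in auto)
    qed
    thus False
      using xy(2) assms(2) by blast
  qed
  hence "is_singleton ?T"
    using parts_meeting_block[OF B] simple unfolding simple_perm_def by blast
  then obtain i where i: "?T = {i}"
    by (rule is_singletonE)
  have "B \<subseteq> part ns i"
  proof
    fix p assume p: "p \<in> B"
    then obtain j where "j \<in> {1..k}" "p \<in> part ns j"
      using xy(2) obtain_part by blast
    hence "j \<in> ?T" "p \<in> part ns j"
      using p by auto
    thus "p \<in> part ns i"
      unfolding i by simp
  qed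
  thus ?thesis using i by blast
qed

lemma not_two_blocks_cover:
  assumes "is_block n \<pi> A" "is_block n \<pi> B" "A \<union> B = {1..n}"
  shows "A = {1..n} \<or> B = {1..n}"
proof (rule ccontr)
  assume "\<not> ?thesis"
  then obtain a b where ab: "A \<subseteq> part ns a" "B \<subseteq> part ns b"
    using assms(1,2) block_in_part_or_full by metis
  have "card {a, b} < card {1, 2, 3 :: nat}"
    by (rule le_less_trans[OF card_insert_le_m1]) auto
  hence "\<not> {1, 2, 3} \<subseteq> {a, b}"
    by (metis card_mono finite.emptyI finite.insertI not_le)
  then obtain c where c: "c \<in> {1, 2, 3}" "c \<noteq> a" "c \<noteq> b"
    by blast
  have "c \<in> {1..k}"
    using c(1) k by auto
  then obtain p where p: "p \<in> part ns c"
    using part_nonempty[OF pos(1)] by blast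
  hence "p \<in> part ns a \<or> p \<in> part ns b"
    using in_part_imp_le[OF p] assms(3) ab by blast
  thus False
    using p c part_unique by blast
qed

end

end

definition maximal_block :: "nat \<Rightarrow> (nat \<Rightarrow> nat) \<Rightarrow> nat set \<Rightarrow> bool" where
  "maximal_block n \<pi> B \<longleftrightarrow> is_block n \<pi> B \<and> B \<noteq> {1..n} \<and>
     (\<forall>C. is_block n \<pi> C \<longrightarrow> B \<subseteq> C \<longrightarrow> C = B \<or> C = {1..n})"

context inflation
begin

lemma part_is_block:
  assumes "i \<in> {1..k}"
  shows "is_block n \<pi> (part ns i)"
proof -
  have "is_block k \<sigma> {i}"
  proof -
    have "{i} = {i..i}" "\<sigma> ` {i} = {\<sigma> i..\<sigma> i}" "{i} \<subseteq> {1..k}"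
      using assms by auto
    thus ?thesis unfolding is_block_def by blast
  qed
  thus ?thesis
    using block_of_inflation by fastforce
qed

lemma part_proper:
  assumes "3 \<le> k" "i \<in> {1..k}"
  shows "part ns i \<noteq> {1..n}"
proof
  assume full: "part ns i = {1..n}"
  define j where "j = (if i = 1 then 2 else 1 :: nat)"
  have j: "j \<in> {1..k}" "j \<noteq> i"
    using assms(1) by (auto simp: j_def)
  then obtain p where "p \<in> part ns j"
    using part_nonempty[OF pos(1)] by blast
  thus False
    using in_part_imp_le[of p ns j] full part_unique j(2) by blast
qed

text \<open>
  This is what makes the decomposition unique: the parts can be read off from \<open>\<pi>\<close> alone.
\<close>

lemma maximal_blocks_are_parts:
  assumes simple: "simple_perm k \<sigma>" and k: "3 \<le> k"
  shows "{B. maximal_block n \<pi> B} = part ns ` {1..k}"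
proof (intro equalityI subsetI)
  fix B assume "B \<in> {B. maximal_block n \<pi> B}"
  hence B: "maximal_block n \<pi> B" by simp
  hence "is_block n \<pi> B" "B \<noteq> {1..n}"
    by (simp_all add: maximal_block_def)
  then obtain i where i: "i \<in> {1..k}" "B \<subseteq> part ns i"
    using block_in_part_or_full[OF simple k] by blast
  show "B \<in> part ns ` {1..k}"
    using i B part_is_block part_proper[OF k i(1)] unfolding maximal_block_def by blast
next
  fix B assume "B \<in> part ns ` {1..k}"
  then obtain i where i: "i \<in> {1..k}" "B = part ns i" by blast
  have "C = B" if C: "is_block n \<pi> C" "B \<subseteq> C" "C \<noteq> {1..n}" for C
  proof -
    obtain j where j: "j \<in> {1..k}" "C \<subseteq> part ns j"
      using block_in_part_or_full[OF simple k C(1,3)] by blast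
    hence "i = j"
      using part_nonempty[OF pos(1) i(1)] C(2) i(2) part_unique by blast
    thus ?thesis
      using C(2) i(2) j(2) by blast
  qed
  thus "B \<in> {B. maximal_block n \<pi> B}"
    unfolding maximal_block_def using i part_proper[OF k i(1)] part_is_block by blast
qed

end

section \<open>The block decomposition\<close>

lemma intervals_Un:
  fixes A B :: "nat set"
  assumes "A = {a..b}" "B = {c..d}" "A \<inter> B \<noteq> {}"
  shows "A \<union> B = {min a c..max b d}"
  using assms by auto

lemma is_block_Un:
  assumes A: "is_block n \<pi> A" and B: "is_block n \<pi> B" and meet: "A \<inter> B \<noteq> {}"
  shows "is_block n \<pi> (A \<union> B)"
proof -
  obtain a b c d where AB: "A = {a..b}" "B = {c..d}"
    using A B unfolding is_block_def by blast
  obtain a' b' c' d' where \<pi>AB: "\<pi> ` A = {a'..b'}" "\<pi> ` B = {c'..d'}"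
    using A B unfolding is_block_def by blast
  have "\<pi> ` A \<inter> \<pi> ` B \<noteq> {}"
    using meet by blast
  hence "\<exists>u v. \<pi> ` (A \<union> B) = {u..v}"
    unfolding image_Un using intervals_Un[OF \<pi>AB] by blast
  moreover have "\<exists>u v. A \<union> B = {u..v}"
    using intervals_Un[OF AB meet] by blast
  moreover have "A \<union> B \<noteq> {}" "A \<union> B \<subseteq> {1..n}"
    using A B unfolding is_block_def by auto
  ultimately show ?thesis
    unfolding is_block_def by blast
qed

text \<open>
  Here \<open>A\<close> is an initial segment \<open>{1..b}\<close>. Its image must contain the value 1 or the value \<open>n\<close>, since otherwise
  the image of the block \<open>B\<close> would contain both and hence be everything. So the image of \<open>A\<close> is an
  initial or a final segment of the values.
\<close>

lemma initial_block_of_cover: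
  assumes \<pi>: "\<pi> permutes {1..n}" and A: "is_block n \<pi> A" and B: "is_block n \<pi> B"
    and cover: "A \<union> B = {1..n}" and proper: "A \<noteq> {1..n}" "B \<noteq> {1..n}" and "1 \<in> A"
  shows "plus_decomposable n \<pi> \<or> minus_decomposable n \<pi>"
proof -
  obtain a b u v where A': "A = {a..b}" "\<pi> ` A = {u..v}" "A \<subseteq> {1..n}"
    using A unfolding is_block_def by blast
  obtain x y where B': "\<pi> ` B = {x..y}" "B \<subseteq> {1..n}"
    using B unfolding is_block_def by blast
  have Ab: "A = {1..b}" "1 \<le> b" "b \<le> n"
    using A'(1) subsetD[OF A'(3), of a] subsetD[OF A'(3), of b] \<open>1 \<in> A\<close> by auto
  hence b: "b < n"
    using proper(1) by (cases "b = n") auto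
  have images: "\<pi> ` A \<union> \<pi> ` B = {1..n}"
    using permutes_image[OF \<pi>] by (simp only: image_Un[symmetric] cover)
  have card: "card {u..v} = b"
    unfolding A'(2)[symmetric] using card_image[OF permutes_inj_on[OF \<pi>], of A] Ab(1) by simp
  have "1 \<in> \<pi> ` A \<or> n \<in> \<pi> ` A"
  proof (rule ccontr)
    assume "\<not> ?thesis"
    moreover have "1 \<in> {1..n}" "n \<in> {1..n}"
      using b by auto
    ultimately have "1 \<in> \<pi> ` B" "n \<in> \<pi> ` B"
      using images by blast+
    hence "{1..n} \<subseteq> \<pi> ` B"
      unfolding B'(1) by auto
    hence "\<pi> ` {1..n} \<subseteq> \<pi> ` B"
      by (simp only: permutes_image[OF \<pi>])
    hence "{1..n} \<subseteq> B"
      by (simp only: inj_image_subset_iff[OF permutes_inj[OF \<pi>]])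
    thus False
      using B'(2) proper(2) by blast
  qed
  moreover have sub: "{u..v} \<subseteq> {1..n}"
    using images A'(2) by blast
  have uv: "u \<in> {1..n}" "v \<in> {1..n}"
    using card Ab(2) subsetD[OF sub, of u] subsetD[OF sub, of v] by (auto simp: Suc_le_eq)
  ultimately consider "u = 1" | "v = n"
    unfolding A'(2) by fastforce
  thus ?thesis
  proof cases
    case 1
    hence "\<pi> ` {1..b} = {1..b}"
      using A'(2) Ab(1) card by simp
    thus ?thesis
      using Ab(2) b unfolding plus_decomposable_def by blast
  next
    case 2
    hence "u = Suc (n - b)"
      using card Ab(2) uv by auto
    hence "\<pi> ` {1..b} = {n - b<..n}"
      using A'(2) Ab(1) 2 by (simp add: atLeastSucAtMost_greaterThanAtMost)
    thus ?thesis
      using Ab(2) b unfolding minus_decomposable_def by blast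
  qed
qed

lemma cover_imp_decomposable:
  assumes "\<pi> permutes {1..n}" "is_block n \<pi> A" "is_block n \<pi> B"
    and "A \<union> B = {1..n}" "A \<noteq> {1..n}" "B \<noteq> {1..n}"
  shows "plus_decomposable n \<pi> \<or> minus_decomposable n \<pi>"
proof -
  have "{1..n} \<noteq> {}"
    using assms(2) unfolding is_block_def by auto
  hence "1 \<in> A \<union> B"
    using assms(4) by simp
  show ?thesis
  proof (cases "1 \<in> A")
    case True
    show ?thesis
      by (rule initial_block_of_cover[OF assms True])
  next
    case False
    hence "1 \<in> B"
      using \<open>1 \<in> A \<union> B\<close> by blast
    moreover have "B \<union> A = {1..n}"
      using assms(4) by (simp only: Un_commute)
    ultimately show ?thesis
      by (intro initial_block_of_cover[OF assms(1,3,2) _ assms(6,5)])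
  qed
qed

lemma ex_maximal_block:
  assumes "is_block n \<pi> B" "B \<noteq> {1..n}"
  shows "\<exists>C. maximal_block n \<pi> C \<and> B \<subseteq> C"
proof -
  let ?S = "{C. is_block n \<pi> C \<and> C \<noteq> {1..n}}"
  have "?S \<subseteq> Pow {1..n}"
    unfolding is_block_def by blast
  hence "finite ?S"
    by (rule finite_subset) simp
  then obtain C where "C \<in> ?S" "B \<subseteq> C" "\<forall>D\<in>?S. C \<subseteq> D \<longrightarrow> C = D"
    using finite_has_maximal2[of ?S B] assms by blast
  thus ?thesis
    unfolding maximal_block_def by blast
qed

lemma singleton_block: "i \<in> {1..n} \<Longrightarrow> is_block n \<pi> {i}"
proof -
  assume "i \<in> {1..n}"
  hence "{i} \<noteq> {}" "{i} \<subseteq> {1..n}" "{i} = {i..i}" "\<pi> ` {i} = {\<pi> i..\<pi> i}" by auto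
  thus ?thesis unfolding is_block_def by blast
qed

text \<open>
  Singletons are proper blocks, so the maximal proper blocks cover everything. If two of them
  meet, their union is a block; by maximality it is everything unless the two are equal, and then
  \<open>\<pi>\<close> is decomposable.
\<close>

lemma maximal_blocks_partition:
  assumes \<pi>: "\<pi> permutes {1..n}" and n: "2 \<le> n"
    and indec: "\<not> plus_decomposable n \<pi>" "\<not> minus_decomposable n \<pi>"
  shows "\<Union>{B. maximal_block n \<pi> B} = {1..n}" "disjoint {B. maximal_block n \<pi> B}"
proof -
  have "\<exists>C. maximal_block n \<pi> C \<and> i \<in> C" if i: "i \<in> {1..n}" for i
  proof -
    have "card {i} \<noteq> card {1..n}" using n by simp
    hence "{i} \<noteq> {1..n}" by metis
    thus ?thesis
      using ex_maximal_block[OF singleton_block[OF i]] by blast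
  qed
  moreover have "C \<subseteq> {1..n}" if "maximal_block n \<pi> C" for C
    using that unfolding maximal_block_def is_block_def by blast
  ultimately show "\<Union>{B. maximal_block n \<pi> B} = {1..n}"
    by blast
  have "A = B" if A: "maximal_block n \<pi> A" and B: "maximal_block n \<pi> B" and meet: "A \<inter> B \<noteq> {}"
    for A B
  proof -
    have AB: "is_block n \<pi> A" "is_block n \<pi> B" "A \<noteq> {1..n}" "B \<noteq> {1..n}"
      using A B by (simp_all add: maximal_block_def)
    have "A \<union> B \<noteq> {1..n}"
      using cover_imp_decomposable[OF \<pi> AB(1,2) _ AB(3,4)] indec by blast
    hence "A \<union> B = A" "A \<union> B = B"
      using is_block_Un[OF AB(1,2) meet] A B unfolding maximal_block_def by blast+
    thus ?thesis by blast
  qed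
  thus "disjoint {B. maximal_block n \<pi> B}"
    by (intro disjointI) blast
qed

text \<open>
  Among three values arranged in a row, two neighbours always differ by one.
\<close>

lemma not_simple_perm_3: "\<not> simple_perm 3 \<sigma>"
proof
  assume simple: "simple_perm 3 \<sigma>"
  hence perm: "\<sigma> permutes {1..3}"
    by (simp add: simple_perm_def)
  have no_block: "\<not> (\<exists>c d. {\<sigma> i, \<sigma> (Suc i)} = {c..d})" if i: "i \<in> {1, 2}" for i
  proof
    assume *: "\<exists>c d. {\<sigma> i, \<sigma> (Suc i)} = {c..d}"
    have eq: "{i, Suc i} = {i..Suc i}" by auto
    have "{i, Suc i} \<subseteq> {1..3}" "{i, Suc i} \<noteq> {}" "\<sigma> ` {i, Suc i} = {\<sigma> i, \<sigma> (Suc i)}"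
      using i by auto
    hence "is_block 3 \<sigma> {i, Suc i}"
      unfolding is_block_def using * eq by metis
    hence "is_singleton {i, Suc i} \<or> {i, Suc i} = {1..3}"
      using simple unfolding simple_perm_def by blast
    moreover have "card {i, Suc i} = 2" by simp
    ultimately show False
      by (auto simp: is_singleton_altdef)
  qed
  have "{p, Suc p} = {p..Suc p}" "{Suc p, p} = {p..Suc p}" for p :: nat
    by auto
  hence far: "\<sigma> (Suc i) \<noteq> Suc (\<sigma> i)" "\<sigma> i \<noteq> Suc (\<sigma> (Suc i))" if "i \<in> {1, 2}" for i
    using no_block[OF that] by metis+
  have range: "1 \<le> \<sigma> i" "\<sigma> i \<le> 3" if "i \<in> {1, 2, 3}" for i
    using permutes_in_image[OF perm, of i] that by auto
  have "\<sigma> 1 \<noteq> \<sigma> 2" "\<sigma> 2 \<noteq> \<sigma> 3" "\<sigma> 1 \<noteq> \<sigma> 3"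
    by (simp_all add: inj_eq[OF permutes_inj[OF perm]])
  moreover have "\<sigma> 1 = 1 \<or> \<sigma> 1 = 2 \<or> \<sigma> 1 = 3" "\<sigma> 2 = 1 \<or> \<sigma> 2 = 2 \<or> \<sigma> 2 = 3"
    "\<sigma> 3 = 1 \<or> \<sigma> 3 = 2 \<or> \<sigma> 3 = 3"
    using range[of 1] range[of 2] range[of 3] by simp_all linarith+
  moreover have "\<sigma> 2 \<noteq> Suc (\<sigma> 1)" "\<sigma> 1 \<noteq> Suc (\<sigma> 2)"
    using far[of 1] by (simp_all add: numeral_2_eq_2)
  moreover have "\<sigma> 3 \<noteq> Suc (\<sigma> 2)" "\<sigma> 2 \<noteq> Suc (\<sigma> 3)"
    using far[of 2] by (simp_all add: numeral_3_eq_3 numeral_2_eq_2)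
  ultimately show False
    by (elim disjE) simp_all
qed

text \<open>
  The maximal blocks cut the positions into parts, and their images cut the values into parts; \<open>\<sigma>\<close>
  records which goes to which. A nontrivial block of \<open>\<sigma>\<close> would be a block of \<open>\<pi>\<close> larger than a maximal
  one, so \<open>\<sigma>\<close> is simple. Its length is not 1 because the blocks are proper, not 2 because \<open>\<pi>\<close> is
  indecomposable in both senses, and not 3 because there is no simple permutation of that length.
\<close>

theorem ex_inflation:
  assumes \<pi>: "\<pi> permutes {1..n}" and n: "2 \<le> n"
    and indec: "\<not> plus_decomposable n \<pi>" "\<not> minus_decomposable n \<pi>"
  shows "\<exists>ns ms \<sigma>. inflation ns ms \<sigma> \<pi> \<and> sum_list ns = n \<and> 4 \<le> length ns \<and>
    simple_perm (length ns) \<sigma>"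
proof -
  define \<P> where "\<P> = {B. maximal_block n \<pi> B}"
  have block: "is_block n \<pi> B" "B \<noteq> {1..n}" if "B \<in> \<P>" for B
    using that by (simp_all add: \<P>_def maximal_block_def)
  have \<P>: "\<Union>\<P> = {1..n}" "disjoint \<P>"
    using maximal_blocks_partition[OF assms] by (simp_all add: \<P>_def)
  obtain ns where ns: "0 \<notin> set ns" "sum_list ns = n" "\<P> = part ns ` {1..length ns}"
    using interval_partition_is_composition[OF \<P>] block(1) unfolding is_block_def by blast
  define \<Q> where "\<Q> = (`) \<pi> ` \<P>"
  have "\<Union>\<Q> = {1..n}"
    using \<P>(1) permutes_image[OF \<pi>] by (simp add: \<Q>_def image_Union[symmetric])
  moreover have "disjoint \<Q>"
    unfolding \<Q>_def using \<P>(2) by (intro disjoint_image permutes_inj_on[OF \<pi>])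
  ultimately obtain ms where ms: "0 \<notin> set ms" "sum_list ms = n" "\<Q> = part ms ` {1..length ms}"
    using interval_partition_is_composition[of \<Q> n] block(1) unfolding is_block_def \<Q>_def
    by blast
  have bij_ns: "bij_betw (part ns) {1..length ns} \<P>"
    unfolding bij_betw_def ns(3) using part_inj[OF ns(1)] by (auto simp: inj_on_def)
  have bij_ms: "bij_betw (part ms) {1..length ms} \<Q>"
    unfolding bij_betw_def ms(3) using part_inj[OF ms(1)] by (auto simp: inj_on_def)
  have "inj_on ((`) \<pi>) \<P>"
    by (rule inj_onI) (simp add: inj_image_eq_iff[OF permutes_inj[OF \<pi>]])
  hence bij_\<pi>: "bij_betw ((`) \<pi>) \<P> \<Q>"
    by (simp add: bij_betw_def \<Q>_def)
  have len: "length ms = length ns"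
    using bij_betw_same_card[OF bij_ns] bij_betw_same_card[OF bij_ms] bij_betw_same_card[OF bij_\<pi>]
    by simp
  define \<tau> where "\<tau> = inv_into {1..length ms} (part ms) \<circ> (\<lambda>i. \<pi> ` part ns i)"
  have image_bij: "bij_betw (\<lambda>i. \<pi> ` part ns i) {1..length ns} \<Q>"
    using bij_betw_trans[OF bij_ns bij_\<pi>] by (simp add: comp_def)
  have \<tau>: "bij_betw \<tau> {1..length ns} {1..length ns}"
    unfolding \<tau>_def using bij_betw_trans[OF image_bij bij_betw_inv_into[OF bij_ms]] len by simp
  have \<tau>_part: "part ms (\<tau> i) = \<pi> ` part ns i" if "i \<in> {1..length ns}" for i
    using bij_betwE[OF image_bij] that unfolding \<tau>_def ms(3) by (simp add: f_inv_into_f)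
  \<comment> \<open>The notion \<open>permutes\<close> requires the identity outside the carrier.\<close>
  define \<sigma> where "\<sigma> i = (if i \<in> {1..length ns} then \<tau> i else i)" for i
  have "\<sigma> permutes {1..length ns}"
    using \<tau> bij_betw_cong[of "{1..length ns}" \<sigma> \<tau> "{1..length ns}"]
    by (intro bij_imp_permutes) (auto simp: \<sigma>_def)
  hence infl: "inflation ns ms \<sigma> \<pi>"
    using ns ms len \<pi> \<tau>_part by unfold_locales (auto simp: \<sigma>_def)
  then interpret infl: inflation ns ms \<sigma> \<pi> .
  have simple: "simple_perm (length ns) \<sigma>"
    unfolding simple_perm_def
  proof (intro conjI allI impI)
    fix T assume T: "is_block (length ns) \<sigma> T"
    show "is_singleton T \<or> T = {1..length ns}"
    proof (rule disjCI)
      assume "T \<noteq> {1..length ns}"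
      moreover have T_sub: "T \<noteq> {}" "T \<subseteq> {1..length ns}"
        using T unfolding is_block_def by auto
      ultimately obtain j where j: "j \<in> {1..length ns}" "j \<notin> T"
        by blast
      obtain i where i: "i \<in> T"
        using T_sub(1) by blast
      let ?U = "\<Union>i\<in>T. part ns i"
      obtain p where p: "p \<in> part ns j"
        using part_nonempty[OF ns(1) j(1)] by blast
      have "p \<notin> ?U"
        using p j(2) part_unique by blast
      hence "?U \<noteq> {1..n}"
        using in_part_imp_le[OF p] ns(2) by blast
      moreover have "is_block n \<pi> ?U"
        using infl.block_of_inflation[OF T] ns(2) by simp
      moreover have "part ns i \<in> \<P>"
        using i T_sub(2) ns(3) by blast
      ultimately have U: "?U = part ns i"
        using i unfolding \<P>_def maximal_block_def by blast
      have "T \<subseteq> {i}"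
      proof
        fix l assume l: "l \<in> T"
        then obtain q where "q \<in> part ns l"
          using part_nonempty[OF ns(1)] T_sub(2) by blast
        thus "l \<in> {i}"
          using l U part_unique by blast
      qed
      hence "T = {i}" using i by blast
      thus "is_singleton T" by simp
    qed
  qed (rule infl.\<sigma>)
  have "length ns \<noteq> 0"
    using ns(2) n by auto
  moreover have "length ns \<noteq> 1"
  proof
    assume "length ns = 1"
    hence "\<P> = {part ns 1}" using ns(3) by simp
    thus False using \<P>(1) block(2) by simp
  qed
  moreover have "length ns \<noteq> 2"
  proof
    assume two: "length ns = 2"
    have parts_in: "part ns 1 \<in> \<P>" "part ns 2 \<in> \<P>"
      using two ns(3) by auto
    have "\<P> = {part ns 1, part ns 2}"
      using two ns(3) by (simp add: numeral_2_eq_2 atLeastAtMostSuc_conv insert_commute)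
    hence "part ns 1 \<union> part ns 2 = {1..n}"
      using \<P>(1) by simp
    thus False
      using cover_imp_decomposable[OF \<pi> block(1)[OF parts_in(1)] block(1)[OF parts_in(2)] _
          block(2)[OF parts_in(1)] block(2)[OF parts_in(2)]] indec by blast
  qed
  moreover have "length ns \<noteq> 3"
    using simple not_simple_perm_3 by metis
  ultimately have "4 \<le> length ns"
    by linarith
  thus ?thesis
    using infl simple ns(2) by blast
qed

text \<open>
  A decomposition would exhibit \<open>{1..n}\<close> as the union of two proper blocks, each contained in a
  single part, although there are at least three parts.
\<close>

lemma (in inflation) indecomposable:
  assumes simple: "simple_perm k \<sigma>" and k: "3 \<le> k"
  shows "\<not> plus_decomposable n \<pi>" "\<not> minus_decomposable n \<pi>"
proof -
  have no_split: False
    if j: "1 \<le> j" "j < n" and image: "\<pi> ` {1..j} = {a..b}" "\<pi> ` {Suc j..n} = {c..d}" for j a b c d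
  proof -
    have "is_block n \<pi> {1..j}" "is_block n \<pi> {Suc j..n}"
      unfolding is_block_def using j image by auto
    moreover have "{1..j} \<union> {Suc j..n} = {1..n}"
      using j by auto
    ultimately have "{1..j} = {1..n} \<or> {Suc j..n} = {1..n}"
      by (rule not_two_blocks_cover[OF simple k])
    moreover have "n \<in> {1..n} - {1..j}" "1 \<in> {1..n} - {Suc j..n}"
      using j by auto
    ultimately show False by blast
  qed
  have rest: "\<pi> ` {Suc j..n} = {1..n} - \<pi> ` {1..j}" if "j < n" for j
  proof -
    have "{Suc j..n} = {1..n} - {1..j}" by auto
    thus ?thesis
      using permutes_image[OF \<pi>] by (simp add: image_set_diff[OF permutes_inj[OF \<pi>]])
  qed
  show "\<not> plus_decomposable n \<pi>"
  proof
    assume "plus_decomposable n \<pi>"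
    then obtain j where j: "1 \<le> j" "j < n" "\<pi> ` {1..j} = {1..j}"
      unfolding plus_decomposable_def by blast
    have "{1..n} - {1..j} = {Suc j..n}" by auto
    thus False
      using no_split[OF j] rest[OF j(2)] j(3) by metis
  qed
  show "\<not> minus_decomposable n \<pi>"
  proof
    assume "minus_decomposable n \<pi>"
    then obtain j where j: "1 \<le> j" "j < n" "\<pi> ` {1..j} = {n - j<..n}"
      unfolding minus_decomposable_def by blast
    have "{1..n} - {n - j<..n} = {1..n - j}" "{n - j<..n} = {Suc (n - j)..n}" by auto
    thus False
      using no_split[OF j(1,2)] rest[OF j(2)] j(3) by metis
  qed
qed

section \<open>Counting simple permutations\<close>

text \<open>
  The composition on the side of the values: the block at height \<open>j\<close> is the one at position
  \<open>inv \<sigma> j\<close>. Lists are indexed from 0, points from 1.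
\<close>

definition image_lengths :: "nat list \<Rightarrow> (nat \<Rightarrow> nat) \<Rightarrow> nat list" where
  "image_lengths ns \<sigma> = map (\<lambda>j. ns ! (inv \<sigma> (Suc j) - 1)) [0..<length ns]"

lemma (in inflation) ms_eq: "ms = image_lengths ns \<sigma>"
proof (rule nth_equalityI)
  fix j assume "j < length ms"
  hence j: "Suc j \<in> {1..k}" using len by auto
  define i where "i = inv \<sigma> (Suc j)"
  have i: "i \<in> {1..k}" "\<sigma> i = Suc j"
    unfolding i_def using permutes_in_image[OF permutes_inv[OF \<sigma>]] j
    by (simp_all add: permutes_inverses[OF \<sigma>])
  have "ms ! j = card (part ms (\<sigma> i))"
    using card_part[of "Suc j" ms] j i(2) len by simp
  also have "\<dots> = card (part ns i)"
    unfolding parts[OF i(1), symmetric] by (rule card_image[OF permutes_inj_on[OF \<pi>]])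
  also have "\<dots> = ns ! (i - 1)"
    by (rule card_part[OF i(1)])
  finally show "ms ! j = image_lengths ns \<sigma> ! j"
    using j by (simp add: image_lengths_def i_def)
qed (simp add: image_lengths_def len)

lemma sum_list_shift: "sum_list ns = (\<Sum>i\<in>{1..length ns}. ns ! (i - 1))"
  unfolding sum_list_sum_nth
  by (rule sum.reindex_bij_witness[of _ "\<lambda>i. i - 1" Suc]) auto

lemma prod_shift: "(\<Prod>i\<in>{1..length ns}. f (ns ! (i - 1))) = (\<Prod>i<length ns. f (ns ! i))"
  by (rule prod.reindex_bij_witness[of _ Suc "\<lambda>i. i - 1"]) auto

lemma image_lengths_props:
  assumes "\<sigma> permutes {1..length ns}" "0 \<notin> set ns"
  shows "length (image_lengths ns \<sigma>) = length ns" "sum_list (image_lengths ns \<sigma>) = sum_list ns"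
    "0 \<notin> set (image_lengths ns \<sigma>)"
    "\<And>i. i \<in> {1..length ns} \<Longrightarrow> image_lengths ns \<sigma> ! (\<sigma> i - 1) = ns ! (i - 1)"
proof -
  have inv_in: "inv \<sigma> j \<in> {1..length ns}" if "j \<in> {1..length ns}" for j
    using permutes_in_image[OF permutes_inv[OF assms(1)], of j] that by simp
  show len: "length (image_lengths ns \<sigma>) = length ns"
    by (simp add: image_lengths_def)
  have nth: "image_lengths ns \<sigma> ! (j - 1) = ns ! (inv \<sigma> j - 1)" if "j \<in> {1..length ns}" for j
    using that by (auto simp: image_lengths_def)
  show "image_lengths ns \<sigma> ! (\<sigma> i - 1) = ns ! (i - 1)" if "i \<in> {1..length ns}" for i
    using nth[of "\<sigma> i"] permutes_in_image[OF assms(1), of i] that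
    by (simp add: permutes_inverses[OF assms(1)])
  have "sum_list (image_lengths ns \<sigma>) = (\<Sum>j\<in>{1..length ns}. ns ! (inv \<sigma> j - 1))"
    unfolding sum_list_shift[of "image_lengths ns \<sigma>"] len by (intro sum.cong refl nth)
  also have "\<dots> = (\<Sum>j\<in>{1..length ns}. ns ! (j - 1))"
    using sum.permute[OF permutes_inv[OF assms(1)], of "\<lambda>i. ns ! (i - 1)"] by (simp add: comp_def)
  finally show "sum_list (image_lengths ns \<sigma>) = sum_list ns"
    by (simp only: sum_list_shift)
  have "ns ! (inv \<sigma> (Suc j) - 1) \<noteq> 0" if "j < length ns" for j
  proof -
    have "inv \<sigma> (Suc j) - 1 < length ns"
      using inv_in[of "Suc j"] that by auto
    thus ?thesis
      using assms(2) by (metis nth_mem)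
  qed
  thus "0 \<notin> set (image_lengths ns \<sigma>)"
    unfolding image_lengths_def set_map by (metis (no_types, lifting) atLeastLessThan_iff imageE set_upt)
qed

definition inflations :: "nat list \<Rightarrow> (nat \<Rightarrow> nat) \<Rightarrow> (nat \<Rightarrow> nat) set" where
  "inflations ns \<sigma> = {\<pi>. inflation ns (image_lengths ns \<sigma>) \<sigma> \<pi>}"

text \<open>
  An inflation is an arbitrary bijection from each part to its prescribed image.
\<close>

lemma card_inflations:
  assumes \<sigma>: "\<sigma> permutes {1..length ns}" and ns: "0 \<notin> set ns"
  shows "card (inflations ns \<sigma>) = (\<Prod>i<length ns. fact (ns ! i))"
proof -
  let ?ms = "image_lengths ns \<sigma>" and ?I = "{1..length ns}"
  note ms = image_lengths_props[OF \<sigma> ns]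
  have \<sigma>_in: "\<sigma> i \<in> ?I" if "i \<in> ?I" for i
    using permutes_in_image[OF \<sigma>] that by blast
  have "inflations ns \<sigma> = {\<pi>. \<pi> permutes {1..sum_list ns} \<and>
      (\<forall>i\<in>?I. \<pi> ` part ns i = part ?ms (\<sigma> i))}"
    unfolding inflations_def inflation_def using assms ms by blast
  also have "card \<dots> = (\<Prod>i\<in>?I. fact (card (part ns i)))"
  proof (rule card_permutes_with_images)
    show "disjoint_family_on (\<lambda>i. part ?ms (\<sigma> i)) ?I"
      unfolding disjoint_family_on_def using part_unique injD[OF permutes_inj[OF \<sigma>]] by blast
    show "card (part ?ms (\<sigma> i)) = card (part ns i)" if "i \<in> ?I" for i
      using card_part[OF that] card_part[of "\<sigma> i" ?ms] \<sigma>_in[OF that] ms(1) ms(4)[OF that] by simp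
    have "(\<Union>i\<in>?I. part ?ms (\<sigma> i)) = (\<Union>j\<in>\<sigma> ` ?I. part ?ms j)"
      by simp
    also have "\<dots> = {1..sum_list ns}"
      using Union_parts[of ?ms] ms(1,2) by (simp only: permutes_image[OF \<sigma>])
    finally show "(\<Union>i\<in>?I. part ?ms (\<sigma> i)) = {1..sum_list ns}" .
  qed (simp_all add: disjoint_parts Union_parts[simplified])
  also have "\<dots> = (\<Prod>i\<in>?I. fact (ns ! (i - 1)))"
    by (intro prod.cong refl) (simp only: card_part)
  finally show ?thesis
    by (simp only: prod_shift)
qed

text \<open>
  The composition \<open>ns\<close> is determined by the maximal blocks of \<open>\<pi>\<close>, the composition of the values by
  their images, and then \<open>\<sigma>\<close> by the correspondence between the two.
\<close>

lemma inflations_determine: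
  assumes "\<pi> \<in> inflations ns \<sigma>" "simple_perm (length ns) \<sigma>" "3 \<le> length ns"
    and "\<pi> \<in> inflations ns' \<sigma>'" "simple_perm (length ns') \<sigma>'" "3 \<le> length ns'"
    and sum: "sum_list ns = sum_list ns'"
  shows "ns = ns' \<and> \<sigma> = \<sigma>'"
proof -
  interpret A: inflation ns "image_lengths ns \<sigma>" \<sigma> \<pi>
    using assms(1) by (simp add: inflations_def)
  interpret B: inflation ns' "image_lengths ns' \<sigma>'" \<sigma>' \<pi>
    using assms(4) by (simp add: inflations_def)
  let ?ms = "image_lengths ns \<sigma>" and ?ms' = "image_lengths ns' \<sigma>'"
  have "part ns ` {1..length ns} = part ns' ` {1..length ns'}"
    using A.maximal_blocks_are_parts[OF assms(2,3)] B.maximal_blocks_are_parts[OF assms(5,6)] sum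
    by simp
  hence ns: "ns = ns'"
    by (rule composition_determined_by_parts[OF A.pos(1) B.pos(1)])
  have images: "part xs ` {1..length xs} = (\<lambda>i. \<pi> ` part ns i) ` {1..length ns}"
    if "inflation ns xs \<tau> \<pi>" for xs \<tau>
  proof -
    interpret inflation ns xs \<tau> \<pi> by fact
    have "(\<lambda>i. \<pi> ` part ns i) ` {1..length ns} = (\<lambda>i. part xs (\<tau> i)) ` {1..length ns}"
      by (intro image_cong refl parts)
    also have "\<dots> = part xs ` \<tau> ` {1..length ns}"
      by (simp only: image_image)
    finally show ?thesis
      by (simp only: permutes_image[OF \<sigma>] len)
  qed
  have "part ?ms ` {1..length ?ms} = part ?ms' ` {1..length ?ms'}"
    using images[OF A.inflation_axioms] images[of ?ms'] B.inflation_axioms ns by simp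
  hence ms: "?ms = ?ms'"
    by (rule composition_determined_by_parts[OF A.pos(2) B.pos(2)])
  have "\<sigma> i = \<sigma>' i" for i
  proof (cases "i \<in> {1..length ns}")
    case True
    have "part ?ms (\<sigma> i) = part ?ms (\<sigma>' i)"
      using A.parts[OF True] B.parts[of i] True ns ms by simp
    moreover have "\<sigma> i \<in> {1..length ?ms}"
      using A.\<sigma>_in[OF True] A.len by simp
    ultimately show ?thesis
      by (intro part_inj[OF A.pos(2)])
  next
    case False
    thus ?thesis
      using permutes_not_in[OF A.\<sigma> False] permutes_not_in[OF B.\<sigma>, of i] ns by simp
  qed
  thus ?thesis using ns by auto
qed

definition compositions :: "nat \<Rightarrow> nat \<Rightarrow> nat list set" where
  "compositions n k = {ns \<in> natpermute n k. 0 \<notin> set ns}"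

lemma fact_fps_power_nth:
  assumes "k \<noteq> 0"
  shows "fps_nth (fact_fps ^ k) n =
    of_nat (\<Sum>ns\<in>compositions n k. \<Prod>i<length ns. fact (ns ! i))"
proof -
  have range: "{0..k - 1} = {..<k}"
    using assms by auto
  have "fps_nth (fact_fps ^ k) n = (\<Sum>ns\<in>natpermute n k. \<Prod>i<k. fps_nth fact_fps (ns ! i))"
    unfolding fps_power_nth range using assms by simp
  also have "\<dots> = (\<Sum>ns\<in>compositions n k. \<Prod>i<k. fps_nth fact_fps (ns ! i))"
  proof (intro sum.mono_neutral_right ballI natpermute_finite)
    fix ns assume "ns \<in> natpermute n k - compositions n k"
    then obtain i where "i < k" "ns ! i = 0"
      by (auto simp: compositions_def natpermute_def in_set_conv_nth)
    thus "(\<Prod>i<k. fps_nth fact_fps (ns ! i)) = 0"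
      by (intro prod_zero) (auto simp: fact_fps_def)
  qed (auto simp: compositions_def)
  also have "\<dots> = (\<Sum>ns\<in>compositions n k. \<Prod>i<length ns. fact (ns ! i))"
  proof (intro sum.cong refl)
    fix ns assume ns: "ns \<in> compositions n k"
    hence len: "length ns = k" and nonzero: "0 \<notin> set ns"
      by (simp_all add: compositions_def natpermute_def)
    have "ns ! i \<noteq> 0" if "i < k" for i
      using that nonzero len by (metis nth_mem)
    with len show "(\<Prod>i<k. fps_nth fact_fps (ns ! i)) = (\<Prod>i<length ns. fact (ns ! i))"
      by (intro prod.cong) (auto simp: fact_fps_def)
  qed
  finally show ?thesis
    by simp
qed

text \<open>
  The permutations that are neither plus nor minus decomposable are the disjoint union of the sets
  of inflations of simple permutations of length at least 4; \<open>\<T>\<close> in the proof indexes these sets.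
\<close>

theorem simple_perm_decomposition_count:
  assumes n: "2 \<le> n"
  shows "2 * num_plus_indecomposable n = fact n +
    (\<Sum>k=4..n. num_simple k * (\<Sum>ns\<in>compositions n k. \<Prod>i<length ns. fact (ns ! i)))"
proof -
  define \<T> where "\<T> = Sigma (\<Union>k\<in>{4..n}. compositions n k) (\<lambda>ns. {\<sigma>. simple_perm (length ns) \<sigma>})"
  have \<T>: "(ns, \<sigma>) \<in> \<T> \<longleftrightarrow>
      0 \<notin> set ns \<and> sum_list ns = n \<and> 4 \<le> length ns \<and> simple_perm (length ns) \<sigma>" for ns \<sigma>
  proof -
    have "length ns \<le> sum_list ns" if "0 \<notin> set ns"
      using that by (induction ns) auto
    thus ?thesis
      by (auto simp: \<T>_def compositions_def natpermute_def)
  qed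
  have fin_simple: "finite {\<sigma>. simple_perm k \<sigma>}" for k
    by (rule finite_subset[OF _ finite_permutations[of "{1..k}"]]) (auto simp: simple_perm_def)
  have fin_comp: "finite (compositions n k)" for k
    by (rule finite_subset[OF _ natpermute_finite[of n k]]) (auto simp: compositions_def)
  have "{\<pi>. \<pi> permutes {1..n} \<and> \<not> plus_decomposable n \<pi> \<and> \<not> minus_decomposable n \<pi>} =
      (\<Union>t\<in>\<T>. inflations (fst t) (snd t))"
  proof (intro equalityI subsetI)
    fix \<pi> assume "\<pi> \<in> {\<pi>. \<pi> permutes {1..n} \<and> \<not> plus_decomposable n \<pi> \<and> \<not> minus_decomposable n \<pi>}"
    then obtain ns ms \<sigma> where infl: "inflation ns ms \<sigma> \<pi>" "sum_list ns = n" "4 \<le> length ns"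
      "simple_perm (length ns) \<sigma>"
      using ex_inflation[OF _ n] by blast
    have "(ns, \<sigma>) \<in> \<T>"
      using infl inflation.pos(1)[OF infl(1)] by (simp add: \<T>)
    moreover have "\<pi> \<in> inflations ns \<sigma>"
      using infl(1) inflation.ms_eq[OF infl(1)] by (simp add: inflations_def)
    ultimately show "\<pi> \<in> (\<Union>t\<in>\<T>. inflations (fst t) (snd t))"
      by force
  next
    fix \<pi> assume "\<pi> \<in> (\<Union>t\<in>\<T>. inflations (fst t) (snd t))"
    then obtain ns \<sigma> where t: "(ns, \<sigma>) \<in> \<T>" "inflation ns (image_lengths ns \<sigma>) \<sigma> \<pi>"
      by (force simp: inflations_def)
    hence "sum_list ns = n" "3 \<le> length ns" "simple_perm (length ns) \<sigma>"
      by (auto simp: \<T>)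
    thus "\<pi> \<in> {\<pi>. \<pi> permutes {1..n} \<and> \<not> plus_decomposable n \<pi> \<and> \<not> minus_decomposable n \<pi>}"
      using inflation.indecomposable[OF t(2)] inflation.\<pi>[OF t(2)] by blast
  qed
  also have "card \<dots> = (\<Sum>t\<in>\<T>. card (inflations (fst t) (snd t)))"
  proof (rule card_UN_disjoint)
    show "finite \<T>"
      unfolding \<T>_def using fin_simple fin_comp by (intro finite_SigmaI finite_UN_I) auto
    have "finite (inflations ns \<sigma>)" for ns \<sigma>
      by (rule finite_subset[OF _ finite_permutations[of "{1..sum_list ns}"]])
        (use inflation.\<pi> in \<open>auto simp: inflations_def\<close>)
    thus "\<forall>t\<in>\<T>. finite (inflations (fst t) (snd t))"
      by blast
    show "\<forall>t\<in>\<T>. \<forall>u\<in>\<T>. t \<noteq> u \<longrightarrow> inflations (fst t) (snd t) \<inter> inflations (fst u) (snd u) = {}"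
    proof (intro ballI impI, rule ccontr)
      fix t u assume tu: "t \<in> \<T>" "u \<in> \<T>" "t \<noteq> u"
        and "inflations (fst t) (snd t) \<inter> inflations (fst u) (snd u) \<noteq> {}"
      then obtain \<pi> where \<pi>: "\<pi> \<in> inflations (fst t) (snd t)" "\<pi> \<in> inflations (fst u) (snd u)"
        by blast
      have "sum_list (fst x) = n" "3 \<le> length (fst x)" "simple_perm (length (fst x)) (snd x)"
        if "x \<in> \<T>" for x
        using \<T>[of "fst x" "snd x"] that by auto
      hence "fst t = fst u \<and> snd t = snd u"
        using inflations_determine[OF \<pi>(1) _ _ \<pi>(2)] tu(1,2) by metis
      thus False
        using tu(3) by (simp add: prod_eq_iff)
    qed
  qed
  also have "\<dots> = (\<Sum>t\<in>\<T>. \<Prod>i<length (fst t). fact (fst t ! i))"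
  proof (intro sum.cong refl)
    fix t assume "t \<in> \<T>"
    hence "0 \<notin> set (fst t)" "snd t permutes {1..length (fst t)}"
      using \<T>[of "fst t" "snd t"] by (auto simp: simple_perm_def)
    thus "card (inflations (fst t) (snd t)) = (\<Prod>i<length (fst t). fact (fst t ! i))"
      by (intro card_inflations)
  qed
  also have "\<dots> = (\<Sum>ns\<in>(\<Union>k\<in>{4..n}. compositions n k). num_simple (length ns) *
      (\<Prod>i<length ns. fact (ns ! i)))"
  proof -
    have "(\<Sum>t\<in>\<T>. f (fst t)) = (\<Sum>ns\<in>(\<Union>k\<in>{4..n}. compositions n k). num_simple (length ns) * f ns)"
      for f :: "nat list \<Rightarrow> nat"
      using sum.Sigma[of "\<Union>k\<in>{4..n}. compositions n k" "\<lambda>ns. {\<sigma>. simple_perm (length ns) \<sigma>}"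
          "\<lambda>ns \<sigma>. f ns"] fin_simple fin_comp
      by (simp add: \<T>_def num_simple_def case_prod_unfold)
    thus ?thesis .
  qed
  also have "\<dots> = (\<Sum>k=4..n. \<Sum>ns\<in>compositions n k. num_simple (length ns) *
      (\<Prod>i<length ns. fact (ns ! i)))"
  proof (rule sum.UNION_disjoint)
    show "\<forall>k\<in>{4..n}. finite (compositions n k)"
      using fin_comp by blast
  qed (auto simp: compositions_def natpermute_def)
  also have "\<dots> = (\<Sum>k=4..n. num_simple k * (\<Sum>ns\<in>compositions n k. \<Prod>i<length ns. fact (ns ! i)))"
    unfolding sum_distrib_left
    by (intro sum.cong refl) (auto simp: compositions_def natpermute_def)
  finally show ?thesis
    using card_doubly_indecomposable[of n] by simp
qed

section \<open>Non-P-recursiveness\<close>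

definition indec_fps :: "complex fps" where
  "indec_fps = Abs_fps (\<lambda>n. if n = 0 then 0 else of_nat (num_plus_indecomposable n))"

definition simple_fps :: "complex fps" where
  "simple_fps = Abs_fps (\<lambda>n. if n < 4 then 0 else of_nat (num_simple n))"

lemma fact_fps_times_indec_fps: "(1 + fact_fps) * indec_fps = fact_fps"
proof (rule fps_ext)
  fix n
  show "fps_nth ((1 + fact_fps) * indec_fps) n = fps_nth fact_fps n"
  proof (cases "n = 0")
    case False
    have "fps_nth ((1 + fact_fps) * indec_fps) n = fps_nth (indec_fps * (1 + fact_fps)) n"
      by (simp only: mult.commute)
    also have "\<dots> = (\<Sum>j=0..n. fps_nth indec_fps j * fact (n - j))"
      unfolding fps_mult_nth fact_fps_nth ..
    also have "\<dots> = (\<Sum>j=1..n. fps_nth indec_fps j * fact (n - j))"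
      by (intro sum.mono_neutral_right) (auto simp: indec_fps_def not_less_eq_eq)
    also have "\<dots> = of_nat (\<Sum>j=1..n. num_plus_indecomposable j * fact (n - j))"
      by (simp add: indec_fps_def)
    also have "\<dots> = fps_nth fact_fps n"
      using False sum_num_plus_indecomposable[of n] by (simp add: fact_fps_def)
    finally show ?thesis .
  qed (simp add: indec_fps_def fact_fps_def)
qed

lemma num_plus_indecomposable_1: "num_plus_indecomposable 1 = 1"
  using sum_num_plus_indecomposable[of 1] by simp

text \<open>
  The generating function form of the preceding count; the inner sum there is a coefficient of
  \<open>F^k\<close>, and the term \<open>x\<close> accounts for the permutation of length 1.
\<close>

lemma indec_fps_eq_simple_fps: "2 * indec_fps - fact_fps = fps_X + (simple_fps oo fact_fps)"
proof (rule fps_ext)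
  fix n
  have double: "fps_nth (2 * A) m = 2 * fps_nth A m" for A :: "complex fps" and m
    by (metis fps_add_nth mult_2)
  have comp: "fps_nth (simple_fps oo fact_fps) n =
      (\<Sum>k=4..n. of_nat (num_simple k) * fps_nth (fact_fps ^ k) n)"
  proof -
    have "fps_nth (simple_fps oo fact_fps) n =
        (\<Sum>k=0..n. fps_nth simple_fps k * fps_nth (fact_fps ^ k) n)"
      by (rule fps_compose_nth)
    also have "\<dots> = (\<Sum>k=4..n. fps_nth simple_fps k * fps_nth (fact_fps ^ k) n)"
      by (intro sum.mono_neutral_right) (auto simp: simple_fps_def)
    finally show ?thesis
      by (simp add: simple_fps_def)
  qed
  show "fps_nth (2 * indec_fps - fact_fps) n = fps_nth (fps_X + (simple_fps oo fact_fps)) n"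
  proof (cases "2 \<le> n")
    case True
    define M where "M = (\<Sum>k=4..n. num_simple k *
      (\<Sum>ns\<in>compositions n k. \<Prod>i<length ns. fact (ns ! i)))"
    have "fps_nth (simple_fps oo fact_fps) n = of_nat M"
      unfolding comp M_def by (simp add: fact_fps_power_nth)
    moreover have "fps_nth (2 * indec_fps - fact_fps) n =
        of_nat (2 * num_plus_indecomposable n) - of_nat (fact n)"
      using True by (simp add: double indec_fps_def fact_fps_def)
    moreover have "2 * num_plus_indecomposable n = fact n + M"
      unfolding M_def by (rule simple_perm_decomposition_count[OF True])
    ultimately show ?thesis
      using True by simp
  next
    case False
    hence "n = 0 \<or> n = 1" by auto
    moreover have "fps_nth (simple_fps oo fact_fps) n = 0"
      unfolding comp using False by simp
    ultimately show ?thesis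
      using num_plus_indecomposable_1
      by (elim disjE) (simp_all add: double indec_fps_def fact_fps_def)
  qed
qed

text \<open>
  Substituting the inverse of \<open>F\<close> into \<open>(1 + F) I = F\<close> and \<open>2 I - F = x + S(F)\<close> and eliminating the
  composed series \<open>I\<close>.
\<close>

lemma com_fps_eq:
  "\<exists>R w. (1 + fps_X) * R = fps_of_poly w \<and> fps_inv fact_fps = R - simple_fps"
proof -
  let ?F = "fact_fps" and ?C = "fps_inv fact_fps"
  have C0: "fps_nth ?C 0 = 0" and F0: "fps_nth ?F 0 = 0"
    by (simp_all add: fps_inv_def fact_fps_def)
  define Z where "Z = indec_fps oo ?C"
  have "(1 + ?F) * indec_fps oo ?C = ?F oo ?C"
    by (simp only: fact_fps_times_indec_fps)
  hence Z: "(1 + fps_X) * Z = fps_X"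
    using C0 by (simp add: Z_def fps_compose_mult_distrib fps_compose_add_distrib fact_fps_inv)
  have "(2 * indec_fps - ?F) oo ?C = (fps_X + (simple_fps oo ?F)) oo ?C"
    by (simp only: indec_fps_eq_simple_fps)
  moreover have "(simple_fps oo ?F) oo ?C = simple_fps"
    using fps_compose_assoc[OF C0 F0, of simple_fps] by (simp add: fact_fps_inv)
  moreover have "2 * indec_fps oo ?C = 2 * Z"
    unfolding mult_2 Z_def by (rule fps_compose_add_distrib)
  ultimately have "2 * Z - fps_X = ?C + simple_fps"
    using C0 by (simp add: fps_compose_sub_distrib fps_compose_add_distrib fact_fps_inv)
  hence "?C = (2 * Z - fps_X) - simple_fps"
    by simp
  moreover have "(1 + fps_X) * (2 * Z - fps_X) = 2 * ((1 + fps_X) * Z) - (1 + fps_X) * fps_X"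
    by (simp add: algebra_simps)
  hence "(1 + fps_X) * (2 * Z - fps_X) = fps_of_poly (2 * [:0, 1:] - [:1, 1:] * [:0, 1:])"
    unfolding Z fps_of_poly_diff fps_of_poly_mult fps_of_poly_fps_X fps_of_poly_linear'
    by (simp add: fps_of_poly_numeral)
  ultimately show ?thesis by blast
qed

theorem corollary4:
  shows "\<not> P_recursive_from 1 (\<lambda>n. of_nat (num_plus_indecomposable n)) \<and>
         \<not> P_recursive_from 1 com_seq \<and>
         \<not> P_recursive_from 1 (\<lambda>n. of_nat (num_simple n))"
proof (intro conjI notI)
  assume "P_recursive_from 1 (\<lambda>n. of_nat (num_plus_indecomposable n))"
  hence "dfinite indec_fps"
    by (rule P_recursive_imp_dfinite[where N = 1]) (simp add: indec_fps_def)
  hence "dfinite (1 - indec_fps)"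
    by (rule dfinite_rational_diff[where w = "[:1, 1:]"]) (simp add: fps_of_poly_linear')
  moreover have "(1 - indec_fps) * (1 + fact_fps) = 1"
    using fact_fps_times_indec_fps by (simp add: algebra_simps)
  ultimately show False
    using reciprocal_not_dfinite by blast
next
  assume "P_recursive_from 1 com_seq"
  hence "dfinite (fps_inv fact_fps)"
    by (rule P_recursive_imp_dfinite[where N = 0]) (simp add: com_seq_def)
  thus False
    using compositional_inverse_not_dfinite by blast
next
  assume "P_recursive_from 1 (\<lambda>n. of_nat (num_simple n))"
  hence "dfinite simple_fps"
    by (rule P_recursive_imp_dfinite[where N = 4]) (simp add: simple_fps_def)
  hence "dfinite (fps_inv fact_fps)"
    using com_fps_eq dfinite_rational_diff by metis
  thus False
    using compositional_inverse_not_dfinite by blast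
qed

end
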